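(* Consider the multigrid setting described in the context, with levels $0,\ldots,L$ ($L\ge 1$), cycle index $\gamma\in\{1,2,\ldots\}$, and the quantities $\sigma_L,\tau_L,\varepsilon_L$, $\sigma_{\rm IMG}^{(k)}$ defined there, and assume $0<\sigma_L<1-\varepsilon_L$. Let $\{x_j\}_{j=1}^{+\infty}\subset(\sigma_L,1-\varepsilon_L)$ be a strictly decreasing sequence with limit $\sigma_L$ such that, for each $j\geq 1$, $x_j$ is a root of the equation $$\frac{\sigma_L\varepsilon_L(1-x^{j})+\tau_L(1-\varepsilon_L)(1-\sigma_L)x^{j}}{\varepsilon_L(1-x^{j})+\tau_L(1-\sigma_L)x^{j}}-x=0\quad(0<x<1).$$ If $$\lambda\big((P_{1}^{T}\widetilde{M}_{1}P_{1})^{-1}(\hat{A}_{0}-A_{0})\big)\subset\bigg[0,\,\frac{\varepsilon_L(x_{\gamma}-\sigma_L)}{(1-\sigma_L)(1-\varepsilon_L-x_{\gamma})}\bigg],$$ then $$\sigma_{\rm IMG}^{(k)}\leq x_{\gamma}\quad\text{for all } k=1,\ldots,L.$$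
   Context: $\lambda(\cdot)$ is the spectrum of a matrix; $\lambda_{\min}(\cdot)$, $\lambda_{\max}(\cdot)$ are the smallest and largest eigenvalues (all matrices to which they are applied here have real spectrum). SPD/SPSD mean symmetric positive definite/semidefinite. For SPD $A$, $\|\mathbf v\|_A=\langle A\mathbf v,\mathbf v\rangle^{1/2}$ and $\|B\|_A=\max_{\mathbf v\ne0}\|B\mathbf v\|_A/\|\mathbf v\|_A$. $M^{-T}=(M^{-1})^T$. Multigrid setting. Integers $n=n_L>n_{L-1}>\cdots>n_0\ge1$. $A_L=A\in\mathbb{R}^{n\times n}$ is SPD. For $k=1,\ldots,L$, $P_k\in\mathbb{R}^{n_k\times n_{k-1}}$ has rank $n_{k-1}$, and for $k=0,\ldots,L-1$, $A_k:=P_{k+1}^TA_{k+1}P_{k+1}$. $\hat A_0\in\mathbb{R}^{n_0\times n_0}$ is such that $\hat A_0-A_0$ is SPSD. For $k=1,\ldots,L$, $M_k\in\mathbb{R}^{n_k\times n_k}$ is nonsingular with $M_k+M_k^T-A_k$ SPD, and $\widetilde M_k:=M_k^T(M_k+M_k^T-A_k)^{-1}M_k$. The multigrid error propagation matrices (cycle index $\gamma$, coarsest system solved with $\hat A_0$) are $$E_{\rm IMG}^{(1)}=(I-M_1^{-T}A_1)(I-P_1\hat A_0^{-1}P_1^TA_1)(I-M_1^{-1}A_1),$$ $$E_{\rm IMG}^{(k)}=(I-M_k^{-T}A_k)\Big[I-P_k\Big(I-\big(E_{\rm IMG}^{(k-1)}\big)^{\gamma}\Big)A_{k-1}^{-1}P_k^TA_k\Big](I-M_k^{-1}A_k),\quad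 k=2,\ldots,L,$$ and the exact two-grid error propagation matrices are $$E_{\rm TG}^{(k)}=(I-M_k^{-T}A_k)(I-P_kA_{k-1}^{-1}P_k^TA_k)(I-M_k^{-1}A_k),\quad k=1,\ldots,L.$$ Set $\sigma_{\rm IMG}^{(k)}:=\|E_{\rm IMG}^{(k)}\|_{A_k}$, $\sigma_{\rm TG}^{(k)}:=\|E_{\rm TG}^{(k)}\|_{A_k}$, and $$\sigma_L:=\max_{1\le k\le L}\sigma_{\rm TG}^{(k)},\quad \tau_L:=\max_{1\le k\le L}\lambda_{\max}\big((P_k^T\widetilde M_kP_k)^{-1}A_{k-1}\big),\quad \varepsilon_L:=\min_{1\le k\le L}\lambda_{\min}(\widetilde M_k^{-1}A_k).$$ *)

theory Defs
  imports
    Complex_Main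
    "Jordan_Normal_Form.Matrix"
    "Jordan_Normal_Form.DL_Rank"
    "Jordan_Normal_Form.Gauss_Jordan_Elimination"
    "Jordan_Normal_Form.Spectral_Radius"
begin

definition spd :: "nat \<Rightarrow> real mat \<Rightarrow> bool" where
  "spd n A \<longleftrightarrow> A \<in> carrier_mat n n \<and> transpose_mat A = A \<and>
     (\<forall>v \<in> carrier_vec n. v \<noteq> 0\<^sub>v n \<longrightarrow> 0 < (A *\<^sub>v v) \<bullet> v)"

definition spsd :: "nat \<Rightarrow> real mat \<Rightarrow> bool" where
  "spsd n A \<longleftrightarrow> A \<in> carrier_mat n n \<and> transpose_mat A = A \<and>
     (\<forall>v \<in> carrier_vec n. 0 \<le> (A *\<^sub>v v) \<bullet> v)"

(* Meaningful for nonsingular matrices only; unspecified otherwise. *)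
definition minv :: "real mat \<Rightarrow> real mat" where
  "minv A = the (mat_inverse A)"

(* spectrum over a real matrix is the set of its real eigenvalues.  Every matrix whose
   spectrum is taken below is a product of an SPD and a symmetric matrix, so it has no others. *)
definition lambda_max :: "real mat \<Rightarrow> real" where
  "lambda_max A = Max (spectrum A)"

definition lambda_min :: "real mat \<Rightarrow> real" where
  "lambda_min A = Min (spectrum A)"

definition energy_norm_vec :: "real mat \<Rightarrow> real vec \<Rightarrow> real" where
  "energy_norm_vec A v = sqrt ((A *\<^sub>v v) \<bullet> v)"

(* For A SPD of positive dimension the supremum is attained. *)
definition energy_norm :: "real mat \<Rightarrow> real mat \<Rightarrow> real" where
  "energy_norm A B =
     (SUP v \<in> carrier_vec (dim_row A) - {0\<^sub>v (dim_row A)}.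
        energy_norm_vec A (B *\<^sub>v v) / energy_norm_vec A v)"

(* M^T (M + M^T - A)^(-1) M *)
definition symm_smoother :: "real mat \<Rightarrow> real mat \<Rightarrow> real mat" where
  "symm_smoother A M = transpose_mat M * minv (M + transpose_mat M - A) * M"

(* Error propagation of one symmetric cycle on a single level, with C the (exact or
   approximate) coarse solver: (I - M^(-T) A) (I - P C P^T A) (I - M^(-1) A). *)
definition cycle_error :: "real mat \<Rightarrow> real mat \<Rightarrow> real mat \<Rightarrow> real mat \<Rightarrow> real mat" where
  "cycle_error A P M C =
     (1\<^sub>m (dim_row A) - transpose_mat (minv M) * A) *
     (1\<^sub>m (dim_row A) - P * C * transpose_mat P * A) *
     (1\<^sub>m (dim_row A) - minv M * A)"

definition E_TG :: "(nat \<Rightarrow> real mat) \<Rightarrow> (nat \<Rightarrow> real mat) \<Rightarrow> (nat \<Rightarrow> real mat) \<Rightarrow> nat \<Rightarrow> real mat" where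
  "E_TG A P M k = cycle_error (A k) (P k) (M k) (minv (A (k - 1)))"

(* Ah is the coarsest-level matrix \hat A_0, g the cycle index; there is no error matrix at level 0. *)
fun E_IMG :: "nat \<Rightarrow> real mat \<Rightarrow> (nat \<Rightarrow> real mat) \<Rightarrow> (nat \<Rightarrow> real mat) \<Rightarrow> (nat \<Rightarrow> real mat)
    \<Rightarrow> nat \<Rightarrow> real mat" where
  "E_IMG g Ah A P M 0 = undefined"
| "E_IMG g Ah A P M (Suc 0) = cycle_error (A 1) (P 1) (M 1) (minv Ah)"
| "E_IMG g Ah A P M (Suc (Suc k)) =
     cycle_error (A (Suc (Suc k))) (P (Suc (Suc k))) (M (Suc (Suc k)))
       ((1\<^sub>m (dim_row (A (Suc k))) - E_IMG g Ah A P M (Suc k) ^\<^sub>m g) * minv (A (Suc k)))"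

definition sigma_TG :: "(nat \<Rightarrow> real mat) \<Rightarrow> (nat \<Rightarrow> real mat) \<Rightarrow> (nat \<Rightarrow> real mat) \<Rightarrow> nat \<Rightarrow> real" where
  "sigma_TG A P M k = energy_norm (A k) (E_TG A P M k)"

definition sigma_IMG :: "nat \<Rightarrow> real mat \<Rightarrow> (nat \<Rightarrow> real mat) \<Rightarrow> (nat \<Rightarrow> real mat) \<Rightarrow> (nat \<Rightarrow> real mat)
    \<Rightarrow> nat \<Rightarrow> real" where
  "sigma_IMG g Ah A P M k = energy_norm (A k) (E_IMG g Ah A P M k)"

definition sigma_max :: "nat \<Rightarrow> (nat \<Rightarrow> real mat) \<Rightarrow> (nat \<Rightarrow> real mat) \<Rightarrow> (nat \<Rightarrow> real mat) \<Rightarrow> real" where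
  "sigma_max L A P M = (MAX k \<in> {1..L}. sigma_TG A P M k)"

definition tau_max :: "nat \<Rightarrow> (nat \<Rightarrow> real mat) \<Rightarrow> (nat \<Rightarrow> real mat) \<Rightarrow> (nat \<Rightarrow> real mat) \<Rightarrow> real" where
  "tau_max L A P M =
     (MAX k \<in> {1..L}.
        lambda_max (minv (transpose_mat (P k) * symm_smoother (A k) (M k) * P k) * A (k - 1)))"

definition eps_min :: "nat \<Rightarrow> (nat \<Rightarrow> real mat) \<Rightarrow> (nat \<Rightarrow> real mat) \<Rightarrow> real" where
  "eps_min L A M = (MIN k \<in> {1..L}. lambda_min (minv (symm_smoother (A k) (M k)) * A k))"

end

theory Submission
  imports Defs
begin

text \<open>
  Write $\widetilde M$ for the symmetrised smoother, $A_c = P^T A P$ and $K = P^T \widetilde M P$ on one level.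
  Each symmetric cycle is $E = S^* N S$ with $S = I - M^{-1}A$, $S^*$ its adjoint in the $A$-inner product,
  $S S^* = I - \widetilde M^{-1}A$, and $N = I - P C P^T A$ for a coarse solver $C$.  Moving $S$ to the
  other side, $E \le x$ in the $A$-inner product as soon as
  $\|S^* N u\|_A^2 \le x \langle N u, u\rangle_A$ for all $u$.

  Put $\delta = \varepsilon(x-\sigma)/((1-\sigma)(1-\varepsilon-x))$.  This inequality holds whenever
  $A_c \le C^{-1} \le A_c + \delta K$: split $h = \widetilde M^{-1} A N u$ into its $\widetilde M$-orthogonal parts
  in and against the range of $P$; the operator $X = A^{-1}\widetilde M$ satisfies $1 \le X \le 1/\varepsilon$ everywhere
  and $X \le 1/(1-\sigma)$ on the second part (the exact two-grid bound), and the off-diagonal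
  block of $X$ is controlled both by $X \le 1/\varepsilon$ and by $(1/\varepsilon - X)(X - 1) \ge 0$.

  On the coarsest level the hypothesis on $C$ is the spectral assumption on $\hat A_0 - A_0$.  On the
  other levels $C^{-1} \le A_c/(1-x^\gamma)$ by induction and $A_c \le \tau K$, so it holds with
  $\delta = \tau x^\gamma/(1-x^\gamma)$; that both values of $\delta$ coincide is exactly the equation
  satisfied by $x = x_\gamma$.
\<close>

section \<open>Bilinear forms, inverses and rank\<close>

text \<open>The value of \<delta> comes from solving 1 - x = (1 + \<delta>) / (1 / (1 - \<sigma>) +
  \<delta> / \<epsilon>) for \<delta>. Here the bounds 1 / (1 - \<sigma>) and 1 / \<epsilon> of X
  are averaged with weights 1 and \<delta>, so x moves from \<sigma> for an exact coarse solver
  towards 1 - \<epsilon> as the coarse error grows. The operators involved are self-adjoint in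
  different inner products and need not commute, so no eigenvector basis is used. Products of
  operators are estimated by one duality device: G \<le> c K implies G K^{-1} G \<le> c G. With D =
  C^{-1} - A_c, the coarse hypothesis is passed on as D K^{-1} D \<le> \<delta> D. Since D C A_c z =
  A_c (z - C A_c z), this can be written with C alone, and a solver made of iterated cycles never
  has to be inverted.\<close>

definition bil :: "real mat \<Rightarrow> real vec \<Rightarrow> real vec \<Rightarrow> real" where
  "bil A u v = (A *\<^sub>v u) \<bullet> v"

lemma bil_add_left:
  assumes "A \<in> carrier_mat n n" "u \<in> carrier_vec n" "v \<in> carrier_vec n" "w \<in> carrier_vec n"
  shows "bil A (u + v) w = bil A u w + bil A v w"
  using assms unfolding bil_def
  by (simp add: mult_add_distrib_mat_vec[of _ n n] add_scalar_prod_distrib[of _ n])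

lemma bil_add_right:
  assumes "A \<in> carrier_mat n n" "u \<in> carrier_vec n" "v \<in> carrier_vec n" "w \<in> carrier_vec n"
  shows "bil A w (u + v) = bil A w u + bil A w v"
  using assms unfolding bil_def by (simp add: scalar_prod_add_distrib[of _ n])

lemma bil_diff_left:
  assumes "A \<in> carrier_mat n n" "u \<in> carrier_vec n" "v \<in> carrier_vec n" "w \<in> carrier_vec n"
  shows "bil A (u - v) w = bil A u w - bil A v w"
  using assms unfolding bil_def
  by (simp add: mult_minus_distrib_mat_vec[of _ n n] minus_scalar_prod_distrib[of _ n])

lemma bil_diff_right:
  assumes "A \<in> carrier_mat n n" "u \<in> carrier_vec n" "v \<in> carrier_vec n" "w \<in> carrier_vec n"
  shows "bil A w (u - v) = bil A w u - bil A w v"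
  using assms unfolding bil_def by (simp add: scalar_prod_minus_distrib[of _ n])

lemma bil_smult_left:
  assumes "A \<in> carrier_mat n n" "u \<in> carrier_vec n" "w \<in> carrier_vec n"
  shows "bil A (c \<cdot>\<^sub>v u) w = c * bil A u w"
  using assms unfolding bil_def by (simp add: mult_mat_vec[of _ n n])

lemma bil_smult_right:
  assumes "A \<in> carrier_mat n n" "u \<in> carrier_vec n" "w \<in> carrier_vec n"
  shows "bil A w (c \<cdot>\<^sub>v u) = c * bil A w u"
  using assms unfolding bil_def by simp

lemmas bil_linear = bil_add_left bil_add_right bil_diff_left bil_diff_right
  bil_smult_left bil_smult_right

lemma mult_mat_vec_zero: "A \<in> carrier_mat n m \<Longrightarrow> A *\<^sub>v 0\<^sub>v m = (0\<^sub>v n :: real vec)"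
  by (intro eq_vecI) auto

lemma bil_zero: "A \<in> carrier_mat n n \<Longrightarrow> u \<in> carrier_vec n \<Longrightarrow> bil A u (0\<^sub>v n) = 0"
  unfolding bil_def by simp

lemma scalar_prod_transpose:
  fixes A :: "real mat"
  assumes "A \<in> carrier_mat n m" "u \<in> carrier_vec m" "v \<in> carrier_vec n"
  shows "(transpose_mat A *\<^sub>v v) \<bullet> u = v \<bullet> (A *\<^sub>v u)"
  using transpose_vec_mult_scalar[OF assms] .

lemma bil_sym:
  assumes "A \<in> carrier_mat n n" "transpose_mat A = A" "u \<in> carrier_vec n" "v \<in> carrier_vec n"
  shows "bil A u v = bil A v u"
  using transpose_vec_mult_scalar[OF assms(1,4,3)] assms
  unfolding bil_def by (simp add: comm_scalar_prod[of _ n])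

lemma scalar_self_pos:
  fixes v :: "real vec"
  assumes "v \<in> carrier_vec n" "v \<noteq> 0\<^sub>v n"
  shows "0 < v \<bullet> v"
proof -
  obtain i where i: "i < n" "v $ i \<noteq> 0"
    using assms by (metis eq_vecI carrier_vecD index_zero_vec)
  have "0 < (v $ i)\<^sup>2" using i by simp
  also have "\<dots> \<le> (\<Sum>j\<in>{0..<n}. v $ j * v $ j)"
    using member_le_sum[of i "{0..<n}" "\<lambda>j. v $ j * v $ j"] i by (simp add: power2_eq_square)
  also have "\<dots> = v \<bullet> v" using assms by (simp add: scalar_prod_def)
  finally show ?thesis .
qed

lemma spdD:
  assumes "spd n A"
  shows "A \<in> carrier_mat n n" "transpose_mat A = A"
    and "\<And>v. v \<in> carrier_vec n \<Longrightarrow> v \<noteq> 0\<^sub>v n \<Longrightarrow> 0 < bil A v v"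
  using assms by (auto simp: spd_def bil_def)

lemma spsdD:
  assumes "spsd n A"
  shows "A \<in> carrier_mat n n" "transpose_mat A = A"
    and "\<And>v. v \<in> carrier_vec n \<Longrightarrow> 0 \<le> bil A v v"
  using assms by (auto simp: spsd_def bil_def)

lemma spsdI:
  assumes "A \<in> carrier_mat n n" "transpose_mat A = A" "\<And>v. v \<in> carrier_vec n \<Longrightarrow> 0 \<le> bil A v v"
  shows "spsd n A"
  using assms by (auto simp: spsd_def bil_def)

lemma spd_imp_spsd: "spd n A \<Longrightarrow> spsd n A"
  by (rule spsdI) (use spdD[of n A] bil_zero[of A n] in \<open>auto, fastforce\<close>)

lemma discriminant_nonneg_quadratic:
  fixes p z r :: real
  assumes "\<And>t. 0 \<le> p + 2 * t * z + t\<^sup>2 * r" and "0 \<le> r"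
  shows "z\<^sup>2 \<le> p * r"
proof (cases "r = 0")
  case True
  have "z = 0"
  proof (rule ccontr)
    assume "z \<noteq> 0"
    \<comment> \<open>With r = 0 the form is affine in t, and this t gives it the value -1.\<close>
    then show False using assms(1)[of "- (p + 1) / (2 * z)"] True by (simp add: field_simps)
  qed
  then show ?thesis using True by simp
next
  case False
  then have "r > 0" using assms(2) by simp
  \<comment> \<open>The minimiser of the quadratic in t.\<close>
  then show ?thesis using assms(1)[of "- z / r"] by (simp add: power2_eq_square field_simps)
qed

text \<open>Semidefinite forms are allowed because later uses concern differences of operators,
  which may be singular.\<close>

lemma bil_cauchy_schwarz:
  assumes "spsd n A" "u \<in> carrier_vec n" "v \<in> carrier_vec n"
  shows "(bil A u v)\<^sup>2 \<le> bil A u u * bil A v v"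
proof (rule discriminant_nonneg_quadratic)
  note A = spsdD[OF assms(1)]
  show "0 \<le> bil A v v" using A(3) assms(3) .
  fix t :: real
  have "0 \<le> bil A (u + t \<cdot>\<^sub>v v) (u + t \<cdot>\<^sub>v v)" using assms by (intro A(3)) auto
  also have "\<dots> = bil A u u + 2 * t * bil A u v + t\<^sup>2 * bil A v v"
    using assms A(1) bil_sym[OF A(1,2) assms(2,3)]
    by (simp add: bil_linear[of _ n] power2_eq_square algebra_simps)
  finally show "0 \<le> \<dots>" .
qed

text \<open>For w = K^{-1} G z this is the step from G \<le> c K to G K^{-1} G \<le> c G. Since
  \<open>bil K w w = bil G z w\<close>, Cauchy--Schwarz in \<open>G\<close> reproduces the factor
  \<open>bil K w w\<close>, which is then cancelled. The comparison of \<open>G\<close> with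
  \<open>K\<close> is needed at \<open>w\<close> only.\<close>

lemma bil_dual_bound:
  assumes G: "spsd n G" and K: "spd n K" and z: "z \<in> carrier_vec n" and w: "w \<in> carrier_vec n"
    and le: "bil G w w \<le> c * bil K w w" and eq: "K *\<^sub>v w = G *\<^sub>v z"
  shows "bil K w w \<le> c * bil G z z"
proof (cases "w = 0\<^sub>v n")
  case True
  have "G *\<^sub>v z = 0\<^sub>v n" using eq True mult_mat_vec_zero[OF spdD(1)[OF K]] by simp
  then show ?thesis using True z spdD(1)[OF K] by (simp add: bil_def)
next
  case False
  then have pos: "0 < bil K w w" using spdD(3)[OF K w] by simp
  have "bil K w w = bil G z w" by (simp add: bil_def eq)
  then have "bil K w w * bil K w w \<le> bil G z z * bil G w w"
    using bil_cauchy_schwarz[OF G z w] by (simp add: power2_eq_square)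
  also have "\<dots> \<le> bil G z z * (c * bil K w w)"
    using le spsdD(3)[OF G z] by (rule mult_left_mono)
  finally have "bil K w w * bil K w w \<le> (c * bil G z z) * bil K w w" by (simp add: mult_ac)
  then show ?thesis using pos by simp
qed

section \<open>Inverses, injectivity and full rank\<close>

lemma minv_of_injective:
  assumes A: "A \<in> carrier_mat n n" and inj: "\<And>v. v \<in> carrier_vec n \<Longrightarrow> A *\<^sub>v v = 0\<^sub>v n \<Longrightarrow> v = 0\<^sub>v n"
  shows "minv A \<in> carrier_mat n n" "A * minv A = 1\<^sub>m n" "minv A * A = 1\<^sub>m n"
proof -
  have "det A \<noteq> 0" using det_0_iff_vec_prod_zero_field[OF A] inj by auto
  then have "A \<in> Units (ring_mat TYPE(real) n n)" by (rule det_non_zero_imp_unit[OF A])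
  then obtain B where B: "mat_inverse A = Some B"
    using mat_inverse(1)[OF A, of n] by (cases "mat_inverse A") auto
  from mat_inverse(2)[OF A B] B
  show "minv A \<in> carrier_mat n n" "A * minv A = 1\<^sub>m n" "minv A * A = 1\<^sub>m n"
    by (auto simp: minv_def)
qed

lemma spd_injective:
  assumes "spd n A" "v \<in> carrier_vec n" "A *\<^sub>v v = 0\<^sub>v n"
  shows "v = 0\<^sub>v n"
  using spdD(3)[OF assms(1,2)] assms by (auto simp: bil_def)

lemmas minv_spd = minv_of_injective[OF spdD(1) spd_injective]

lemma invertible_mat_injective:
  fixes A :: "real mat"
  assumes A: "A \<in> carrier_mat n n" and "invertible_mat A" and v: "v \<in> carrier_vec n" "A *\<^sub>v v = 0\<^sub>v n"
  shows "v = 0\<^sub>v n"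
proof -
  obtain B where B: "A * B = 1\<^sub>m n" "B * A = 1\<^sub>m (dim_row B)"
    using assms(1,2) by (auto simp: invertible_mat_def inverts_mat_def)
  have "dim_row B = n" "dim_col B = n"
    using A B by (metis carrier_matD(2) index_mult_mat(3) index_one_mat(3))
      (metis A B(1) index_mult_mat(3) index_one_mat(3))
  then have Bc: "B \<in> carrier_mat n n" by auto
  have "v = (B * A) *\<^sub>v v" using B v \<open>dim_row B = n\<close> by simp
  also have "\<dots> = B *\<^sub>v (A *\<^sub>v v)" using Bc A v by simp
  also have "\<dots> = 0\<^sub>v n" using v Bc by auto
  finally show ?thesis .
qed

lemma inverse_mult_vec:
  fixes A B :: "real mat"
  assumes "A \<in> carrier_mat n n" "B \<in> carrier_mat n n" "A * B = 1\<^sub>m n" "v \<in> carrier_vec n"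
  shows "A *\<^sub>v (B *\<^sub>v v) = v"
proof -
  have "A *\<^sub>v (B *\<^sub>v v) = (A * B) *\<^sub>v v" using assms(1,2,4) by (rule assoc_mult_mat_vec[symmetric])
  also have "\<dots> = v" unfolding assms(3) using assms(4) by simp
  finally show ?thesis .
qed

lemma symmetric_inverse:
  fixes A B :: "real mat"
  assumes "A \<in> carrier_mat n n" "B \<in> carrier_mat n n" "A * B = 1\<^sub>m n" "B * A = 1\<^sub>m n" "transpose_mat A = A"
  shows "transpose_mat B = B"
proof -
  have 1: "transpose_mat B * A = 1\<^sub>m n"
    using transpose_mult[OF assms(1,2)] assms by simp
  have "transpose_mat B = transpose_mat B * (A * B)" using assms by simp
  also have "\<dots> = transpose_mat B * A * B" using assms by (simp add: assoc_mult_mat[of _ n n _ n _ n])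
  also have "\<dots> = B" using 1 assms by simp
  finally show ?thesis .
qed

text \<open>Linear independence concerns the set of columns, in which a repeated column is
  invisible, so distinctness has to come first. A maximal independent subset has m elements, hence
  the set of columns has at least m elements and none of the m columns is repeated.\<close>

lemma full_rank_injective:
  fixes P :: "real mat"
  assumes P: "P \<in> carrier_mat n m" and r: "vec_space.rank n P = m"
    and v: "v \<in> carrier_vec m" "P *\<^sub>v v = 0\<^sub>v n"
  shows "v = 0\<^sub>v m"
proof (rule ccontr)
  assume nz: "v \<noteq> 0\<^sub>v m"
  interpret vec_space "TYPE(real)" n .
  have "lin_indpt {}" unfolding lin_dep_def by auto
  then have "\<exists>S. finite S \<and> maximal S (\<lambda>T. T \<subseteq> set (cols P) \<and> lin_indpt T) \<and> {} \<subseteq> S"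
    by (intro maximal_exists_superset[where S = "set (cols P)"]) auto
  then obtain S where S: "maximal S (\<lambda>T. T \<subseteq> set (cols P) \<and> lin_indpt T)" by blast
  then have "m = card S" using rank_card_indpt[OF P S] r by simp
  also have "\<dots> \<le> card (set (cols P))" using S by (simp add: card_mono maximal_def)
  finally have "card (set (cols P)) = length (cols P)"
    using P card_length[of "cols P"] by simp
  then have d: "distinct (cols P)" by (rule card_distinct)
  show False using full_rank_lin_indpt[OF P r d] lin_depI[OF P v(1) nz v(2) d] by contradiction
qed

section \<open>Generalised Rayleigh quotients\<close>

lemma bil_bounded:
  assumes G: "G \<in> carrier_mat n n"
  obtains c where "0 < c" "\<And>v. v \<in> carrier_vec n \<Longrightarrow> bil G v v \<le> c * (v \<bullet> v)"
proof
  \<comment> \<open>The summand 1 keeps c positive even for the zero matrix.\<close>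
  define c where "c = 1 + (\<Sum>i\<in>{0..<n}. \<Sum>j\<in>{0..<n}. \<bar>G $$ (i, j)\<bar>)"
  show "0 < c" unfolding c_def by (intro add_pos_nonneg sum_nonneg) auto
  fix v :: "real vec" assume v: "v \<in> carrier_vec n"
  define S where "S = v \<bullet> v"
  have S: "S = (\<Sum>j\<in>{0..<n}. v $ j * v $ j)" using v by (simp add: S_def scalar_prod_def)
  have S0: "0 \<le> S" unfolding S by (intro sum_nonneg) auto
  have sq: "(v $ j)\<^sup>2 \<le> S" if "j < n" for j
    using member_le_sum[of j "{0..<n}" "\<lambda>j. v $ j * v $ j"] that
    by (simp add: S power2_eq_square)
  have pr: "\<bar>v $ j * v $ i\<bar> \<le> S" if "i < n" "j < n" for i j
  proof -
    have "2 * \<bar>v $ j * v $ i\<bar> \<le> (v $ j)\<^sup>2 + (v $ i)\<^sup>2"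
      using sum_squares_bound[of "\<bar>v $ j\<bar>" "\<bar>v $ i\<bar>"] by (simp add: abs_mult)
    then show ?thesis using sq[OF that(1)] sq[OF that(2)] by linarith
  qed
  have "bil G v v = (\<Sum>i\<in>{0..<n}. (\<Sum>j\<in>{0..<n}. G $$ (i, j) * v $ j) * v $ i)"
    using v G by (simp add: bil_def scalar_prod_def)
  also have "\<dots> = (\<Sum>i\<in>{0..<n}. \<Sum>j\<in>{0..<n}. G $$ (i, j) * (v $ j * v $ i))"
    by (simp add: sum_distrib_right mult.assoc)
  also have "\<dots> \<le> (\<Sum>i\<in>{0..<n}. \<Sum>j\<in>{0..<n}. \<bar>G $$ (i, j)\<bar> * S)"
  proof (intro sum_mono)
    fix i j assume ij: "i \<in> {0..<n}" "j \<in> {0..<n}"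
    have "G $$ (i, j) * (v $ j * v $ i) \<le> \<bar>G $$ (i, j)\<bar> * \<bar>v $ j * v $ i\<bar>"
      by (metis abs_ge_self abs_mult)
    also have "\<dots> \<le> \<bar>G $$ (i, j)\<bar> * S" using pr[of i j] ij by (intro mult_left_mono) auto
    finally show "G $$ (i, j) * (v $ j * v $ i) \<le> \<bar>G $$ (i, j)\<bar> * S" .
  qed
  also have "\<dots> = (c - 1) * S" by (simp add: c_def sum_distrib_right)
  also have "\<dots> \<le> c * S" using S0 by (simp add: algebra_simps)
  finally show "bil G v v \<le> c * (v \<bullet> v)" by (simp add: S_def)
qed

text \<open>Cauchy--Schwarz in the \<open>K\<close>-inner product for \<open>v\<close> and \<open>K\<^sup>-\<^sup>1 v\<close> replaces the usual
  compactness argument on the unit sphere.\<close>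

lemma spd_coercive:
  assumes K: "spd n K"
  obtains c where "0 < c" "\<And>v. v \<in> carrier_vec n \<Longrightarrow> v \<bullet> v \<le> c * bil K v v"
proof -
  note Ki = minv_spd[OF K K, simplified]
  obtain c where c: "0 < c" "\<And>v. v \<in> carrier_vec n \<Longrightarrow> bil (minv K) v v \<le> c * (v \<bullet> v)"
    using bil_bounded[OF Ki(1)] by blast
  have "v \<bullet> v \<le> c * bil K v v" if v: "v \<in> carrier_vec n" for v
  proof (cases "v = 0\<^sub>v n")
    case True
    then show ?thesis using bil_zero[OF spdD(1)[OF K] v] by simp
  next
    case False
    define w where "w = minv K *\<^sub>v v"
    have w: "w \<in> carrier_vec n" "K *\<^sub>v w = v"
      using Ki v inverse_mult_vec[OF spdD(1)[OF K] Ki(1,2) v] by (auto simp: w_def)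
    have pos: "0 < v \<bullet> v" using scalar_self_pos v False by blast
    have "(v \<bullet> v)\<^sup>2 \<le> bil K w w * bil K v v"
      using bil_cauchy_schwarz[OF spd_imp_spsd[OF K] w(1) v] by (simp add: bil_def w)
    also have "bil K w w = bil (minv K) v v"
      using v w by (simp add: bil_def w_def[symmetric] comm_scalar_prod[of _ n])
    also have "\<dots> * bil K v v \<le> (c * (v \<bullet> v)) * bil K v v"
      using c(2)[OF v] spsdD(3)[OF spd_imp_spsd[OF K] v] by (intro mult_right_mono) auto
    finally have "(v \<bullet> v) * (v \<bullet> v) \<le> (v \<bullet> v) * (c * bil K v v)"
      by (simp add: power2_eq_square algebra_simps)
    then show ?thesis using pos by simp
  qed
  then show ?thesis using that c(1) by blast
qed

text \<open>Plays the role of norm equivalence in finite dimension: it makes Rayleigh quotients and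
  energy norms bounded, and it supplies the gap in \<open>rayleigh_sup_attained\<close>.\<close>

lemma bil_le_spd:
  assumes K: "spd n K" and G: "G \<in> carrier_mat n n"
  obtains c where "0 < c" "\<And>v. v \<in> carrier_vec n \<Longrightarrow> bil G v v \<le> c * bil K v v"
proof -
  obtain a where a: "0 < a" "\<And>v. v \<in> carrier_vec n \<Longrightarrow> bil G v v \<le> a * (v \<bullet> v)"
    using bil_bounded[OF G] by blast
  obtain b where b: "0 < b" "\<And>v. v \<in> carrier_vec n \<Longrightarrow> v \<bullet> v \<le> b * bil K v v"
    using spd_coercive[OF K] by blast
  have "bil G v v \<le> (a * b) * bil K v v" if "v \<in> carrier_vec n" for v
  proof -
    have "bil G v v \<le> a * (v \<bullet> v)" using a(2)[OF that] .
    also have "\<dots> \<le> a * (b * bil K v v)" using b(2)[OF that] a(1) by (intro mult_left_mono) auto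
    finally show ?thesis by (simp add: mult.assoc)
  qed
  then show ?thesis using that[of "a * b"] a(1) b(1) by simp
qed

lemma bil_minus_mat:
  assumes "A \<in> carrier_mat n n" "B \<in> carrier_mat n n" "u \<in> carrier_vec n" "v \<in> carrier_vec n"
  shows "bil (A - B) u v = bil A u v - bil B u v"
  using assms unfolding bil_def
  by (simp add: minus_mult_distrib_mat_vec[of _ n n] minus_scalar_prod_distrib[of _ n])

lemma smult_mat_mult_vec:
  fixes A :: "real mat"
  assumes "A \<in> carrier_mat n m" "v \<in> carrier_vec m"
  shows "(c \<cdot>\<^sub>m A) *\<^sub>v v = c \<cdot>\<^sub>v (A *\<^sub>v v)"
  using assms by (intro eq_vecI) (auto simp: scalar_prod_def sum_distrib_left mult.assoc)

lemma bil_smult_mat: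
  assumes "A \<in> carrier_mat n n" "u \<in> carrier_vec n" "v \<in> carrier_vec n"
  shows "bil (c \<cdot>\<^sub>m A) u v = c * bil A u v"
  using assms unfolding bil_def by (simp add: smult_mat_mult_vec[of _ n n])

text \<open>Cauchy--Schwarz against the test vector \<open>K v\<close>, for which the left side is
  the square of the squared length of \<open>K v\<close>.\<close>

lemma spsd_kernel:
  assumes K: "spsd n K" and v: "v \<in> carrier_vec n" and "bil K v v = 0"
  shows "K *\<^sub>v v = 0\<^sub>v n"
proof (rule ccontr)
  assume nz: "K *\<^sub>v v \<noteq> 0\<^sub>v n"
  have Kv: "K *\<^sub>v v \<in> carrier_vec n" using spsdD(1)[OF K] v by simp
  have "(bil K v (K *\<^sub>v v))\<^sup>2 \<le> 0"
    using bil_cauchy_schwarz[OF K v Kv] assms(3) by simp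
  then show False using scalar_self_pos[OF Kv nz] by (simp add: bil_def)
qed

lemma unit_vec_nonzero: "1 \<le> n \<Longrightarrow> unit_vec n 0 \<noteq> (0\<^sub>v n :: real vec)"
  using arg_cong[of "unit_vec n 0" "0\<^sub>v n :: real vec" "\<lambda>v. v $ 0"] by auto

text \<open>The supremum \<mu> is attained without a compactness argument. The form of \<mu> G - H
  is semidefinite. If it were definite, it would dominate G / c for some c > 0, and the quotient
  would stay below \<mu> - 1 / c, against the choice of \<mu>. So it vanishes at some nonzero v, and
  \<open>spsd_kernel\<close> turns this into the eigenvector equation.\<close>

lemma rayleigh_sup_attained:
  assumes n: "1 \<le> n" and G: "spd n G" and H: "H \<in> carrier_mat n n" "transpose_mat H = H"
  obtains \<mu> v where "v \<in> carrier_vec n" "v \<noteq> 0\<^sub>v n" "H *\<^sub>v v = \<mu> \<cdot>\<^sub>v (G *\<^sub>v v)"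
    and "\<And>w. w \<in> carrier_vec n \<Longrightarrow> bil H w w \<le> \<mu> * bil G w w"
proof -
  note Gd = spdD[OF G]
  define X where "X = carrier_vec n - {0\<^sub>v n :: real vec}"
  define f where "f = (\<lambda>v. bil H v v / bil G v v)"
  define \<mu> where "\<mu> = (SUP v\<in>X. f v)"
  have "unit_vec n 0 \<in> X" using unit_vec_nonzero[OF n] by (simp add: X_def)
  then have ne: "X \<noteq> {}" by blast
  obtain c0 where c0: "\<And>v. v \<in> carrier_vec n \<Longrightarrow> bil H v v \<le> c0 * bil G v v"
    using bil_le_spd[OF G H(1)] by blast
  have bdd: "bdd_above (f ` X)"
  proof (rule bdd_aboveI2)
    fix w assume "w \<in> X"
    then have "w \<in> carrier_vec n" "0 < bil G w w" using Gd(3) by (auto simp: X_def)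
    then show "f w \<le> c0" using c0[of w] by (simp add: f_def pos_divide_le_eq)
  qed
  have le: "bil H w w \<le> \<mu> * bil G w w" if w: "w \<in> carrier_vec n" for w
  proof (cases "w = 0\<^sub>v n")
    case True
    then show ?thesis using bil_zero[OF Gd(1) w] bil_zero[OF H(1) w] by simp
  next
    case False
    then have "f w \<le> \<mu>" using cSUP_upper[OF _ bdd] w by (auto simp: X_def \<mu>_def)
    then show ?thesis using Gd(3)[OF w False] by (simp add: f_def pos_divide_le_eq)
  qed
  define K where "K = \<mu> \<cdot>\<^sub>m G - H"
  have Kc: "K \<in> carrier_mat n n" using H(1) unfolding K_def by (rule minus_carrier_mat)
  have bilK: "bil K w w = \<mu> * bil G w w - bil H w w" if "w \<in> carrier_vec n" for w
    using that Gd H by (simp add: K_def bil_minus_mat[of _ n] bil_smult_mat[of _ n])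
  have Ksym: "transpose_mat K = K"
  proof -
    have "transpose_mat (\<mu> \<cdot>\<^sub>m G) = \<mu> \<cdot>\<^sub>m transpose_mat G" by (intro eq_matI) auto
    then show ?thesis using Gd H transpose_minus[of "\<mu> \<cdot>\<^sub>m G" n n H] by (simp add: K_def)
  qed
  have K: "spsd n K" using Kc Ksym le bilK by (intro spsdI) auto
  have "\<exists>v\<in>X. bil K v v = 0"
  proof (rule ccontr)
    assume none: "\<not> ?thesis"
    have "spd n K" unfolding spd_def bil_def[symmetric]
      using none Kc Ksym spsdD(3)[OF K] by (auto simp: X_def order_less_le)
    then obtain c where c: "0 < c" "\<And>v. v \<in> carrier_vec n \<Longrightarrow> bil G v v \<le> c * bil K v v"
      using bil_le_spd[OF _ Gd(1)] by blast
    have "f w \<le> \<mu> - 1 / c" if w: "w \<in> X" for w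
    proof -
      have w: "w \<in> carrier_vec n" "w \<noteq> 0\<^sub>v n" using w by (auto simp: X_def)
      have "bil G w w / c \<le> bil K w w" using c(1) c(2)[OF w(1)]
        by (simp add: pos_divide_le_eq mult.commute)
      then have "bil H w w \<le> (\<mu> - 1 / c) * bil G w w"
        using bilK[OF w(1)] by (simp add: left_diff_distrib)
      then show ?thesis using Gd(3)[OF w] by (simp add: f_def pos_divide_le_eq)
    qed
    then have "\<mu> \<le> \<mu> - 1 / c" unfolding \<mu>_def by (intro cSUP_least[OF ne]) auto
    then show False using c(1) by simp
  qed
  then obtain v where v: "v \<in> carrier_vec n" "v \<noteq> 0\<^sub>v n" "bil K v v = 0" by (auto simp: X_def)
  have "K *\<^sub>v v = \<mu> \<cdot>\<^sub>v (G *\<^sub>v v) - H *\<^sub>v v"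
    using v Gd H by (simp add: K_def minus_mult_distrib_mat_vec[of _ n n] smult_mat_mult_vec[of _ n n])
  then have z: "\<mu> \<cdot>\<^sub>v (G *\<^sub>v v) - H *\<^sub>v v = 0\<^sub>v n" using spsd_kernel[OF K v(1,3)] by simp
  have "H *\<^sub>v v = \<mu> \<cdot>\<^sub>v (G *\<^sub>v v)"
  proof (rule eq_vecI)
    show "dim_vec (H *\<^sub>v v) = dim_vec (\<mu> \<cdot>\<^sub>v (G *\<^sub>v v))" using Gd H by simp
    fix i assume "i < dim_vec (\<mu> \<cdot>\<^sub>v (G *\<^sub>v v))"
    then have "i < n" using Gd by simp
    then show "(H *\<^sub>v v) $ i = (\<mu> \<cdot>\<^sub>v (G *\<^sub>v v)) $ i"
      using arg_cong[OF z, of "\<lambda>u. u $ i"] Gd H v by simp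
  qed
  with v le show ?thesis using that by blast
qed

section \<open>Generalised eigenvalues and the extreme points of the spectrum\<close>

lemma generalized_eigenvalue:
  assumes G: "spd n G" and H: "H \<in> carrier_mat n n"
  shows "\<mu> \<in> spectrum (minv G * H) \<longleftrightarrow>
    (\<exists>v\<in>carrier_vec n. v \<noteq> 0\<^sub>v n \<and> H *\<^sub>v v = \<mu> \<cdot>\<^sub>v (G *\<^sub>v v))"
proof -
  note Gd = spdD[OF G] and Gi = minv_spd[OF G G, simplified]
  have "minv G *\<^sub>v (H *\<^sub>v v) = \<mu> \<cdot>\<^sub>v v \<longleftrightarrow> H *\<^sub>v v = \<mu> \<cdot>\<^sub>v (G *\<^sub>v v)" if v: "v \<in> carrier_vec n" for v
  proof
    have Hv: "H *\<^sub>v v \<in> carrier_vec n" using H v by simp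
    assume "minv G *\<^sub>v (H *\<^sub>v v) = \<mu> \<cdot>\<^sub>v v"
    then have "G *\<^sub>v (minv G *\<^sub>v (H *\<^sub>v v)) = G *\<^sub>v (\<mu> \<cdot>\<^sub>v v)" by simp
    then show "H *\<^sub>v v = \<mu> \<cdot>\<^sub>v (G *\<^sub>v v)"
      unfolding inverse_mult_vec[OF Gd(1) Gi(1,2) Hv] mult_mat_vec[OF Gd(1) v] .
  next
    have Gv: "G *\<^sub>v v \<in> carrier_vec n" using Gd v by simp
    assume "H *\<^sub>v v = \<mu> \<cdot>\<^sub>v (G *\<^sub>v v)"
    then have "minv G *\<^sub>v (H *\<^sub>v v) = minv G *\<^sub>v (\<mu> \<cdot>\<^sub>v (G *\<^sub>v v))" by simp
    then show "minv G *\<^sub>v (H *\<^sub>v v) = \<mu> \<cdot>\<^sub>v v"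
      unfolding mult_mat_vec[OF Gi(1) Gv] inverse_mult_vec[OF Gi(1) Gd(1) Gi(3) v] .
  qed
  moreover have "minv G * H *\<^sub>v v = minv G *\<^sub>v (H *\<^sub>v v)" if "v \<in> carrier_vec n" for v
    using Gi(1) H that by (rule assoc_mult_mat_vec)
  moreover have "dim_row (minv G * H) = n" using Gi(1) by simp
  ultimately show ?thesis
    unfolding spectrum_def eigenvalue_def eigenvector_def mem_Collect_eq by metis
qed

lemma spectral_upper_bound:
  assumes n: "1 \<le> n" and G: "spd n G" and H: "H \<in> carrier_mat n n" "transpose_mat H = H"
  obtains \<mu> where "\<mu> \<in> spectrum (minv G * H)"
    and "\<And>w. w \<in> carrier_vec n \<Longrightarrow> bil H w w \<le> \<mu> * bil G w w"
proof (rule rayleigh_sup_attained[OF assms])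
  fix \<mu> v
  assume "v \<in> carrier_vec n" "v \<noteq> 0\<^sub>v n" "H *\<^sub>v v = \<mu> \<cdot>\<^sub>v (G *\<^sub>v v)"
    and "\<And>w. w \<in> carrier_vec n \<Longrightarrow> bil H w w \<le> \<mu> * bil G w w"
  then show thesis using generalized_eigenvalue[OF G H(1)] that by blast
qed

lemma spectral_lower_bound:
  assumes n: "1 \<le> n" and G: "spd n G" and H: "H \<in> carrier_mat n n" "transpose_mat H = H"
  obtains \<mu> where "\<mu> \<in> spectrum (minv G * H)"
    and "\<And>w. w \<in> carrier_vec n \<Longrightarrow> \<mu> * bil G w w \<le> bil H w w"
proof -
  have mH: "- H \<in> carrier_mat n n" "transpose_mat (- H) = - H"
    using H by (auto simp: transpose_uminus)
  obtain \<mu> v where v: "v \<in> carrier_vec n" "v \<noteq> 0\<^sub>v n" "- H *\<^sub>v v = \<mu> \<cdot>\<^sub>v (G *\<^sub>v v)"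
    and le: "\<And>w. w \<in> carrier_vec n \<Longrightarrow> bil (- H) w w \<le> \<mu> * bil G w w"
    by (rule rayleigh_sup_attained[OF n G mH]) blast
  have mHv: "- (H *\<^sub>v v) = \<mu> \<cdot>\<^sub>v (G *\<^sub>v v)" using v H by simp
  have "H *\<^sub>v v = - \<mu> \<cdot>\<^sub>v (G *\<^sub>v v)"
  proof (rule eq_vecI)
    show "dim_vec (H *\<^sub>v v) = dim_vec (- \<mu> \<cdot>\<^sub>v (G *\<^sub>v v))" using spdD(1)[OF G] H by simp
    fix i assume "i < dim_vec (- \<mu> \<cdot>\<^sub>v (G *\<^sub>v v))"
    then have "i < n" using spdD(1)[OF G] by simp
    then show "(H *\<^sub>v v) $ i = (- \<mu> \<cdot>\<^sub>v (G *\<^sub>v v)) $ i"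
      using arg_cong[OF mHv, of "\<lambda>u. u $ i"] spdD(1)[OF G] H
      by (simp del: index_mult_mat_vec)
  qed
  then have "- \<mu> \<in> spectrum (minv G * H)" using generalized_eigenvalue[OF G H(1)] v by blast
  moreover have "- \<mu> * bil G w w \<le> bil H w w" if "w \<in> carrier_vec n" for w
    using le[OF that] that H by (simp add: bil_def)
  ultimately show ?thesis using that by blast
qed

text \<open>The spectrum is finite, so \<open>Max\<close> dominates the one eigenvalue already known
  to bound the Rayleigh quotient; the two need not be identified.\<close>

lemma lambda_max_bound:
  assumes "1 \<le> n" and G: "spd n G" and H: "H \<in> carrier_mat n n" "transpose_mat H = H"
    and w: "w \<in> carrier_vec n"
  shows "bil H w w \<le> lambda_max (minv G * H) * bil G w w"
proof -
  obtain \<mu> where \<mu>: "\<mu> \<in> spectrum (minv G * H)" "bil H w w \<le> \<mu> * bil G w w"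
    by (rule spectral_upper_bound[OF assms(1-4)]) (use w in blast)
  have "finite (spectrum (minv G * H))"
    by (rule card_finite_spectrum(1)[OF mult_carrier_mat[OF minv_spd(1)[OF G G] H(1)]])
  then have "\<mu> \<le> lambda_max (minv G * H)" using \<mu>(1) by (simp add: lambda_max_def)
  then have "\<mu> * bil G w w \<le> lambda_max (minv G * H) * bil G w w"
    using spsdD(3)[OF spd_imp_spsd[OF G] w] by (rule mult_right_mono)
  then show ?thesis using \<mu>(2) by linarith
qed

text \<open>Positivity holds because the minimum of a finite nonempty spectrum is itself an
  eigenvalue, and at its eigenvector it is a quotient of two positive energies.\<close>

lemma lambda_min_bound:
  assumes "1 \<le> n" and G: "spd n G" and H: "spd n H"
  shows "0 < lambda_min (minv G * H)"
    and "w \<in> carrier_vec n \<Longrightarrow> lambda_min (minv G * H) * bil G w w \<le> bil H w w"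
proof -
  note Hd = spdD[OF H]
  obtain \<mu> where \<mu>: "\<mu> \<in> spectrum (minv G * H)"
      "\<And>w. w \<in> carrier_vec n \<Longrightarrow> \<mu> * bil G w w \<le> bil H w w"
    by (rule spectral_lower_bound[OF assms(1,2) Hd(1,2)]) blast
  have fin: "finite (spectrum (minv G * H))"
    by (rule card_finite_spectrum(1)[OF mult_carrier_mat[OF minv_spd(1)[OF G G] Hd(1)]])
  then have "lambda_min (minv G * H) \<in> spectrum (minv G * H)"
    using \<mu>(1) unfolding lambda_min_def by (intro Min_in) auto
  then obtain v where v: "v \<in> carrier_vec n" "v \<noteq> 0\<^sub>v n"
      "H *\<^sub>v v = lambda_min (minv G * H) \<cdot>\<^sub>v (G *\<^sub>v v)"
    using generalized_eigenvalue[OF G Hd(1)] by blast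
  have "bil H v v = lambda_min (minv G * H) * bil G v v"
    using v spdD(1)[OF G] by (simp add: bil_def)
  then show "0 < lambda_min (minv G * H)"
    using Hd(3)[OF v(1,2)] spdD(3)[OF G v(1,2)] by (metis zero_less_mult_pos2)
  assume w: "w \<in> carrier_vec n"
  have "lambda_min (minv G * H) \<le> \<mu>" using fin \<mu>(1) by (simp add: lambda_min_def)
  then have "lambda_min (minv G * H) * bil G w w \<le> \<mu> * bil G w w"
    using spsdD(3)[OF spd_imp_spsd[OF G] w] by (rule mult_right_mono)
  then show "lambda_min (minv G * H) * bil G w w \<le> bil H w w" using \<mu>(2)[OF w] by linarith
qed

section \<open>Congruences, and the scalar inequalities behind one level\<close>

lemma bil_congruence:
  assumes "A \<in> carrier_mat n n" "P \<in> carrier_mat n m" "u \<in> carrier_vec m" "v \<in> carrier_vec m"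
  shows "bil (transpose_mat P * A * P) u v = bil A (P *\<^sub>v u) (P *\<^sub>v v)"
proof -
  have "(transpose_mat P * A * P) *\<^sub>v u = transpose_mat P *\<^sub>v (A *\<^sub>v (P *\<^sub>v u))"
    using assms by (simp add: assoc_mult_mat_vec[of _ m n _ m] assoc_mult_mat_vec[of _ m n _ n])
  then show ?thesis
    unfolding bil_def using scalar_prod_transpose[OF assms(2,4), of "A *\<^sub>v (P *\<^sub>v u)"] assms by simp
qed

lemma spd_congruence:
  assumes A: "spd n A" and P: "P \<in> carrier_mat n m"
    and inj: "\<And>v. v \<in> carrier_vec m \<Longrightarrow> P *\<^sub>v v = 0\<^sub>v n \<Longrightarrow> v = 0\<^sub>v m"
  shows "spd m (transpose_mat P * A * P)"
proof -
  note Ad = spdD[OF A]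
  have sym: "transpose_mat (transpose_mat P * A * P) = transpose_mat P * A * P"
    using Ad(1,2) P transpose_mult[of "transpose_mat P * A" m n P m] transpose_mult[of "transpose_mat P" m n A n]
    by (simp add: assoc_mult_mat[of _ m n _ n _ m])
  have pos: "0 < bil A (P *\<^sub>v v) (P *\<^sub>v v)" if "v \<in> carrier_vec m" "v \<noteq> 0\<^sub>v m" for v
    using Ad(3)[of "P *\<^sub>v v"] inj[OF that(1)] that P by auto
  show ?thesis unfolding spd_def bil_def[symmetric]
    using pos bil_congruence[OF Ad(1) P] Ad(1) P sym by auto
qed

lemma spd_minv:
  assumes R: "spd n R"
  shows "spd n (minv R)"
proof -
  note Ri = minv_spd[OF R R, simplified] and Rd = spdD[OF R]
  have sym: "transpose_mat (minv R) = minv R"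
    using symmetric_inverse[OF Rd(1) Ri(1,2,3) Rd(2)] .
  have "0 < bil (minv R) v v" if v: "v \<in> carrier_vec n" "v \<noteq> 0\<^sub>v n" for v
  proof -
    define w where "w = minv R *\<^sub>v v"
    have w: "w \<in> carrier_vec n" "R *\<^sub>v w = v"
      using Ri v inverse_mult_vec[OF Rd(1) Ri(1,2) v(1)] by (auto simp: w_def)
    then have "w \<noteq> 0\<^sub>v n" using v(2) mult_mat_vec_zero[OF Rd(1)] by auto
    then have "0 < bil R w w" using Rd(3) w(1) by blast
    then show ?thesis using w v by (simp add: bil_def w_def[symmetric] comm_scalar_prod[of _ n])
  qed
  then show ?thesis unfolding spd_def bil_def[symmetric] using Ri(1) sym by auto
qed

lemma minv_invertible:
  assumes M: "M \<in> carrier_mat n n" and "invertible_mat M"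
  shows "minv M \<in> carrier_mat n n" "M * minv M = 1\<^sub>m n" "minv M * M = 1\<^sub>m n"
  using minv_of_injective[OF M] invertible_mat_injective[OF assms] by auto

text \<open>The form of X on an orthogonal splitting into two vectors, reduced to numbers: \<alpha>
  and \<beta> are the squared norms of the parts, Xa, \<zeta>, Xb the entries of X, e = 1 /
  \<epsilon> and s = 1 / (1 - \<sigma>). The two bounds on the square of \<zeta> are mixed with
  weights \<delta> and 1. They share the factor e \<beta> - Xb, so the mixture is a product, and the
  arithmetic-geometric mean inequality makes the estimate linear.\<close>

lemma two_by_two_form_bound:
  fixes \<alpha> \<beta> Xa Xb \<zeta> e s \<delta> :: real
  assumes pos: "0 \<le> \<alpha>" "0 \<le> \<beta>" "0 < \<delta>" "1 \<le> s"
    and a: "Xa \<le> e * \<alpha>" and b: "\<beta> \<le> Xb" "Xb \<le> s * \<beta>" "Xb \<le> e * \<beta>"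
    and h1: "\<zeta>\<^sup>2 \<le> (e * \<alpha> - Xa) * (e * \<beta> - Xb)"
    and h2: "0 < \<beta> \<Longrightarrow> \<beta> * \<zeta>\<^sup>2 \<le> \<alpha> * ((e * \<beta> - Xb) * (Xb - \<beta>))"
  shows "(1 + \<delta>) * (Xa + 2 * \<zeta> + Xb) \<le> (s + \<delta> * e) * \<beta> + (1 + \<delta>) * ((e + (s - 1) / \<delta>) * \<alpha>)"
proof (cases "\<beta> = 0")
  case True
  then have "Xb = 0" using b by simp
  then have "\<zeta> = 0" using h1 True by simp
  have "0 \<le> (s - 1) / \<delta> * \<alpha>" using pos by (intro mult_nonneg_nonneg divide_nonneg_pos) auto
  then have "Xa \<le> (e + (s - 1) / \<delta>) * \<alpha>" using a by (simp only: distrib_right)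
  then show ?thesis using True \<open>Xb = 0\<close> \<open>\<zeta> = 0\<close> pos by simp
next
  case False
  then have \<beta>: "0 < \<beta>" using pos by simp
  \<comment> \<open>The Rayleigh quotient of X on the second part.\<close>
  define t where "t = Xb / \<beta>"
  have Xb: "Xb = t * \<beta>" using \<beta> by (simp add: t_def)
  have t: "1 \<le> t" "t \<le> s" using b \<beta> by (auto simp: Xb)
  \<comment> \<open>\<open>U\<close> and \<open>W\<close> are the two factors of 1 + \<delta> times
    the mixture. They are scaled so that adding U + W also removes Xa and \<delta> Xb from the sum
    to be bounded.\<close>
  define U where "U = \<delta> * (e * \<beta> - Xb)"
  define W where "W = (1 + \<delta>) * ((e * \<alpha> - Xa) + (t - 1) * \<alpha> / \<delta>)"
  have "0 \<le> (t - 1) * \<alpha> / \<delta>" using pos t by (intro divide_nonneg_pos mult_nonneg_nonneg) auto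
  then have W0: "0 \<le> W" unfolding W_def using pos a by (intro mult_nonneg_nonneg) auto
  have U0: "0 \<le> U" unfolding U_def using pos b by (intro mult_nonneg_nonneg) auto
  have "\<beta> * \<zeta>\<^sup>2 \<le> \<beta> * (\<alpha> * ((e * \<beta> - Xb) * (t - 1)))"
    using h2[OF \<beta>] by (simp add: Xb algebra_simps)
  then have z2: "\<zeta>\<^sup>2 \<le> \<alpha> * ((e * \<beta> - Xb) * (t - 1))" using \<beta> by simp
  have "((1 + \<delta>) * \<zeta>)\<^sup>2 = (1 + \<delta>) * (\<delta> * \<zeta>\<^sup>2 + \<zeta>\<^sup>2)" by (simp add: power2_eq_square algebra_simps)
  also have "\<dots> \<le> (1 + \<delta>) * (\<delta> * ((e * \<alpha> - Xa) * (e * \<beta> - Xb)) + \<alpha> * ((e * \<beta> - Xb) * (t - 1)))"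
    using h1 z2 pos by (intro mult_left_mono add_mono) auto
  also have "\<dots> = U * W"
  proof -
    have reorder: "\<delta> * p * ((1 + \<delta>) * (q + r)) = (1 + \<delta>) * (p * (\<delta> * q + \<delta> * r))" for p q r
      by (simp add: algebra_simps)
    have "\<delta> * ((t - 1) * \<alpha> / \<delta>) = (t - 1) * \<alpha>" using pos(3) by simp
    moreover have "U * W = (1 + \<delta>) * ((e * \<beta> - Xb) * (\<delta> * (e * \<alpha> - Xa) + \<delta> * ((t - 1) * \<alpha> / \<delta>)))"
      unfolding U_def W_def by (rule reorder)
    ultimately have "U * W = (1 + \<delta>) * ((e * \<beta> - Xb) * (\<delta> * (e * \<alpha> - Xa) + (t - 1) * \<alpha>))"
      by (simp only:)
    moreover have "(1 + \<delta>) * (\<delta> * (q * p) + \<alpha> * (p * r)) = (1 + \<delta>) * (p * (\<delta> * q + r * \<alpha>))" for p q r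
      by (simp add: algebra_simps)
    ultimately show ?thesis by (simp only:)
  qed
  finally have "((1 + \<delta>) * \<zeta>)\<^sup>2 \<le> U * W" .
  moreover have "4 * (U * W) \<le> (U + W)\<^sup>2"
    using zero_le_power2[of "U - W"] by (simp add: power2_eq_square algebra_simps)
  moreover have four_sq: "(2::real)\<^sup>2 = 4" by simp
  ultimately have "(2 * ((1 + \<delta>) * \<zeta>))\<^sup>2 \<le> (U + W)\<^sup>2"
    unfolding power_mult_distrib[of 2 "(1 + \<delta>) * \<zeta>"] four_sq by linarith
  then have zUW: "2 * ((1 + \<delta>) * \<zeta>) \<le> U + W" by (rule power2_le_imp_le) (use U0 W0 in linarith)
  have "(1 + \<delta>) * (Xa + 2 * \<zeta> + Xb) = (1 + \<delta>) * Xa + 2 * ((1 + \<delta>) * \<zeta>) + (1 + \<delta>) * Xb"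
    by (simp add: algebra_simps)
  also have "\<dots> \<le> (1 + \<delta>) * Xa + (U + W) + (1 + \<delta>) * Xb" using zUW by (intro add_mono) auto
  also have "\<dots> = (t + \<delta> * e) * \<beta> + (1 + \<delta>) * ((e + (t - 1) / \<delta>) * \<alpha>)"
  proof -
    have "(1 + \<delta>) * Xa + (\<delta> * (e * \<beta> - t * \<beta>) + (1 + \<delta>) * (e * \<alpha> - Xa + r * \<alpha>)) + (1 + \<delta>) * (t * \<beta>)
        = (t + \<delta> * e) * \<beta> + (1 + \<delta>) * ((e + r) * \<alpha>)" for r
      by (simp add: algebra_simps)
    from this[of "(t - 1) / \<delta>"] show ?thesis
      unfolding U_def W_def Xb times_divide_eq_left[symmetric] .
  qed
  \<comment> \<open>Both coefficients increase with t, so the two-grid bound t \<le> s gives the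
    worst case.\<close>
  also have "\<dots> \<le> (s + \<delta> * e) * \<beta> + (1 + \<delta>) * ((e + (s - 1) / \<delta>) * \<alpha>)"
  proof (rule add_mono)
    show "(t + \<delta> * e) * \<beta> \<le> (s + \<delta> * e) * \<beta>" using t pos by (intro mult_right_mono) auto
    have "(t - 1) / \<delta> \<le> (s - 1) / \<delta>" using t pos by (intro divide_right_mono) auto
    then have "(e + (t - 1) / \<delta>) * \<alpha> \<le> (e + (s - 1) / \<delta>) * \<alpha>" using pos by (intro mult_right_mono) auto
    then show "(1 + \<delta>) * ((e + (t - 1) / \<delta>) * \<alpha>) \<le> (1 + \<delta>) * ((e + (s - 1) / \<delta>) * \<alpha>)"
      using pos by (intro mult_left_mono) auto
  qed
  finally show ?thesis .
qed

text \<open>The left side is the energy after post-smoothing. The bracket on the right is a lower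
  bound for the energy product of N u and u, in which \<alpha> / \<delta> is the gain from the
  coarse hypothesis. With the prescribed \<delta>, multiplying \<open>two_by_two_form_bound\<close>
  by (1 - x) / (1 + \<delta>) turns the coefficient of \<beta> into 1, and that of \<alpha> into 1 +
  x / \<delta>.\<close>

lemma contraction_bound:
  fixes \<alpha> \<beta> Xa Xb \<zeta> \<sigma> \<epsilon> x \<delta> :: real
  assumes par: "0 < \<epsilon>" "0 \<le> \<sigma>" "\<sigma> < x" "x < 1 - \<epsilon>"
    and \<delta>: "\<delta> = \<epsilon> * (x - \<sigma>) / ((1 - \<sigma>) * (1 - \<epsilon> - x))"
    and pos: "0 \<le> \<alpha>" "0 \<le> \<beta>"
    and a: "Xa \<le> 1 / \<epsilon> * \<alpha>" and b: "\<beta> \<le> Xb" "Xb - \<beta> \<le> \<sigma> * Xb" "Xb \<le> 1 / \<epsilon> * \<beta>"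
    and h1: "\<zeta>\<^sup>2 \<le> (1 / \<epsilon> * \<alpha> - Xa) * (1 / \<epsilon> * \<beta> - Xb)"
    and h2: "0 < \<beta> \<Longrightarrow> \<beta> * \<zeta>\<^sup>2 \<le> \<alpha> * ((1 / \<epsilon> * \<beta> - Xb) * (Xb - \<beta>))"
  shows "(Xa + 2 * \<zeta> + Xb) - (\<alpha> + \<beta>) \<le> x * ((Xa + 2 * \<zeta> + Xb) + \<alpha> / \<delta>)"
proof -
  define s where "s = 1 / (1 - \<sigma>)"
  define e where "e = 1 / \<epsilon>"
  have \<sigma>1: "0 < 1 - \<sigma>" "0 < 1 - \<epsilon> - x" using par by auto
  have \<delta>0: "0 < \<delta>" unfolding \<delta> using par \<sigma>1 by (intro divide_pos_pos mult_pos_pos) auto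
  have s1: "1 \<le> s" using \<sigma>1 par by (simp add: s_def)
  have bs: "Xb \<le> s * \<beta>"
  proof -
    have "Xb * (1 - \<sigma>) \<le> \<beta>" using b(2) by (simp add: algebra_simps)
    then show ?thesis using \<sigma>1(1) by (simp add: s_def pos_le_divide_eq)
  qed
  have "\<delta> * ((1 - \<sigma>) * (1 - \<epsilon> - x)) = \<epsilon> * (x - \<sigma>)" using \<sigma>1 by (simp add: \<delta>)
  \<comment> \<open>The definition of \<delta>, solved for 1 - x.\<close>
  then have "(1 - x) * (\<epsilon> + \<delta> * (1 - \<sigma>)) = (1 + \<delta>) * ((1 - \<sigma>) * \<epsilon>)" by (simp add: algebra_simps)
  moreover have "s + \<delta> * e = (\<epsilon> + \<delta> * (1 - \<sigma>)) / ((1 - \<sigma>) * \<epsilon>)"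
    using \<sigma>1(1) par(1) by (simp add: s_def e_def add_divide_distrib)
  ultimately have y: "(1 - x) * (s + \<delta> * e) = 1 + \<delta>" using \<sigma>1(1) par(1) by simp
  have "(1 - x) * (e + (s - 1) / \<delta>) = ((1 - x) * (s + \<delta> * e) - (1 - x)) / \<delta>"
  proof -
    have "e + (s - 1) / \<delta> = (s + \<delta> * e - 1) / \<delta>" using \<delta>0 by (simp add: add_divide_distrib diff_divide_distrib)
    then have "(1 - x) * (e + (s - 1) / \<delta>) = (1 - x) * (s + \<delta> * e - 1) / \<delta>" by simp
    also have "(1 - x) * (s + \<delta> * e - 1) = (1 - x) * (s + \<delta> * e) - (1 - x)" by (simp add: right_diff_distrib)
    finally show ?thesis .
  qed
  then have y': "(1 - x) * (e + (s - 1) / \<delta>) = 1 + x / \<delta>"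
    unfolding y using \<delta>0 by (simp add: add_divide_distrib)
  have main: "(1 + \<delta>) * (Xa + 2 * \<zeta> + Xb) \<le> (s + \<delta> * e) * \<beta> + (1 + \<delta>) * ((e + (s - 1) / \<delta>) * \<alpha>)"
    by (rule two_by_two_form_bound[OF pos \<delta>0 s1]) (use a b(1) bs b(3) h1 h2 in \<open>auto simp: e_def\<close>)
  have gen: "(1 - x) * (p * \<beta> + (1 + \<delta>) * (q * \<alpha>))
      = ((1 - x) * p) * \<beta> + (1 + \<delta>) * (((1 - x) * q) * \<alpha>)" for p q
    by (simp add: algebra_simps)
  have "(1 + \<delta>) * ((1 - x) * (Xa + 2 * \<zeta> + Xb)) = (1 - x) * ((1 + \<delta>) * (Xa + 2 * \<zeta> + Xb))" by simp
  also have "\<dots> \<le> (1 - x) * ((s + \<delta> * e) * \<beta> + (1 + \<delta>) * ((e + (s - 1) / \<delta>) * \<alpha>))"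
    using main par by (intro mult_left_mono) auto
  also have "\<dots> = ((1 - x) * (s + \<delta> * e)) * \<beta> + (1 + \<delta>) * (((1 - x) * (e + (s - 1) / \<delta>)) * \<alpha>)"
    by (rule gen)
  also have "\<dots> = (1 + \<delta>) * (\<beta> + (1 + x / \<delta>) * \<alpha>)" unfolding y y' by (simp only: distrib_left)
  finally have "(1 - x) * (Xa + 2 * \<zeta> + Xb) \<le> \<beta> + (1 + x / \<delta>) * \<alpha>" using \<delta>0 by simp
  then show ?thesis by (simp add: algebra_simps)
qed

section \<open>One level of the cycle\<close>

locale smoothed_level =
  fixes n :: nat and A M :: "real mat"
  assumes spd_A: "spd n A" and M_carrier: "M \<in> carrier_mat n n" and invertible_M: "invertible_mat M"
    and spd_R: "spd n (M + transpose_mat M - A)"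
begin

abbreviation "Mt \<equiv> symm_smoother A M"

text \<open>\<open>pre\<close> is the factor S of the overview acting on vectors, and
  \<open>post\<close> is its adjoint in the \<open>A\<close>-inner product.\<close>

definition post :: "real vec \<Rightarrow> real vec" where
  "post v = v - transpose_mat (minv M) *\<^sub>v (A *\<^sub>v v)"

definition pre :: "real vec \<Rightarrow> real vec" where
  "pre v = v - minv M *\<^sub>v (A *\<^sub>v v)"

lemmas A_carrier = spdD(1)[OF spd_A] and A_sym = spdD(2)[OF spd_A]
lemmas Mi = minv_invertible[OF M_carrier invertible_M]

lemma A_nonneg: "v \<in> carrier_vec n \<Longrightarrow> 0 \<le> bil A v v"
  using spsdD(3)[OF spd_imp_spsd[OF spd_A]] .

lemma minv_transpose_cancel:
  assumes "v \<in> carrier_vec n"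
  shows "transpose_mat M *\<^sub>v (transpose_mat (minv M) *\<^sub>v v) = v"
    and "transpose_mat (minv M) *\<^sub>v (transpose_mat M *\<^sub>v v) = v"
proof -
  have "transpose_mat M * transpose_mat (minv M) = 1\<^sub>m n"
    using transpose_mult[OF Mi(1) M_carrier] Mi(3) by simp
  then show "transpose_mat M *\<^sub>v (transpose_mat (minv M) *\<^sub>v v) = v"
    using Mi(1) M_carrier assms by (intro inverse_mult_vec[of _ n]) auto
  have "transpose_mat (minv M) * transpose_mat M = 1\<^sub>m n"
    using transpose_mult[OF M_carrier Mi(1)] Mi(2) by simp
  then show "transpose_mat (minv M) *\<^sub>v (transpose_mat M *\<^sub>v v) = v"
    using Mi(1) M_carrier assms by (intro inverse_mult_vec[of _ n]) auto
qed

lemma post_carrier [simp]: "v \<in> carrier_vec n \<Longrightarrow> post v \<in> carrier_vec n"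
  using Mi(1) A_carrier by (simp add: post_def)

lemma pre_carrier [simp]: "v \<in> carrier_vec n \<Longrightarrow> pre v \<in> carrier_vec n"
  using Mi(1) A_carrier by (simp add: pre_def)

lemma post_adjoint:
  assumes u: "u \<in> carrier_vec n" and v: "v \<in> carrier_vec n"
  shows "bil A (post u) v = bil A u (pre v)"
proof -
  have Au: "A *\<^sub>v u \<in> carrier_vec n" and Av: "A *\<^sub>v v \<in> carrier_vec n" using A_carrier u v by auto
  have c: "transpose_mat (minv M) *\<^sub>v (A *\<^sub>v u) \<in> carrier_vec n" "minv M *\<^sub>v (A *\<^sub>v v) \<in> carrier_vec n"
    using Mi(1) Au Av by auto
  have "bil A (transpose_mat (minv M) *\<^sub>v (A *\<^sub>v u)) v = bil A v (transpose_mat (minv M) *\<^sub>v (A *\<^sub>v u))"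
    using bil_sym[OF A_carrier A_sym c(1) v] .
  also have "\<dots> = (transpose_mat (minv M) *\<^sub>v (A *\<^sub>v u)) \<bullet> (A *\<^sub>v v)"
    unfolding bil_def using comm_scalar_prod[OF Av c(1)] .
  also have "\<dots> = bil A u (minv M *\<^sub>v (A *\<^sub>v v))"
    unfolding bil_def by (rule scalar_prod_transpose[OF Mi(1) Av Au])
  finally show ?thesis
    unfolding post_def pre_def using u v c
    by (simp add: bil_diff_left[OF A_carrier] bil_diff_right[OF A_carrier])
qed

lemma spd_Mt: "spd n Mt"
  unfolding symm_smoother_def
  by (rule spd_congruence[OF spd_minv[OF spd_R] M_carrier])
    (rule invertible_mat_injective[OF M_carrier invertible_M])

lemmas Mt_carrier = spdD(1)[OF spd_Mt] and Mt_sym = spdD(2)[OF spd_Mt]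

text \<open>This is S S' = I - Mt^{-1} A as a quadratic form, where S' is the adjoint of S and h =
  Mt^{-1} A f is given by an equation. The vector z = M^{-T} A f satisfies R z = M h for R = M + M^T
  - A. Hence \<open>bil A f h = bil R z z\<close>, and writing out R produces exactly the terms in
  the energy of f - z.\<close>

lemma post_energy:
  assumes f: "f \<in> carrier_vec n" and h: "h \<in> carrier_vec n" and eq: "Mt *\<^sub>v h = A *\<^sub>v f"
  shows "bil A (post f) (post f) = bil A f f - bil A f h"
proof -
  define R where "R = M + transpose_mat M - A"
  have R: "spd n R" using spd_R by (simp add: R_def)
  note Rc = spdD(1)[OF R] and Ri = minv_spd[OF R R, simplified]
  define r where "r = A *\<^sub>v f"
  define z where "z = transpose_mat (minv M) *\<^sub>v r"
  have r: "r \<in> carrier_vec n" using A_carrier f by (simp add: r_def)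
  have z: "z \<in> carrier_vec n" using Mi(1) r by (simp add: z_def)
  have Mh: "M *\<^sub>v h \<in> carrier_vec n" using M_carrier h by simp
  have RMh: "minv R *\<^sub>v (M *\<^sub>v h) \<in> carrier_vec n" using Ri(1) Mh by simp
  have "Mt *\<^sub>v h = transpose_mat M *\<^sub>v (minv R *\<^sub>v (M *\<^sub>v h))"
    unfolding symm_smoother_def R_def[symmetric] using M_carrier Ri(1) h
    by (simp add: assoc_mult_mat_vec[of _ n n _ n])
  then have "r = transpose_mat M *\<^sub>v (minv R *\<^sub>v (M *\<^sub>v h))" using eq by (simp add: r_def)
  then have "z = minv R *\<^sub>v (M *\<^sub>v h)" unfolding z_def using minv_transpose_cancel(2)[OF RMh] by simp
  then have Rz: "R *\<^sub>v z = M *\<^sub>v h" using inverse_mult_vec[OF Rc Ri(1,2) Mh] by simp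
  have MTz: "transpose_mat M *\<^sub>v z = r" unfolding z_def using minv_transpose_cancel(1)[OF r] .
  have "bil A f h = r \<bullet> h" by (simp add: bil_def r_def)
  also have "\<dots> = z \<bullet> (M *\<^sub>v h)" using scalar_prod_transpose[OF M_carrier h z] MTz by simp
  also have "\<dots> = bil R z z" unfolding bil_def Rz using comm_scalar_prod[OF z Mh] .
  also have "\<dots> = bil M z z + bil (transpose_mat M) z z - bil A z z"
    unfolding R_def bil_def using M_carrier A_carrier z
    by (simp add: minus_mult_distrib_mat_vec[of _ n n] add_mult_distrib_mat_vec[of _ n n]
        minus_scalar_prod_distrib[of _ n] add_scalar_prod_distrib[of _ n])
  also have "bil M z z = r \<bullet> z"
    unfolding bil_def using scalar_prod_transpose[OF M_carrier z z] MTz M_carrier z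
    by (simp add: comm_scalar_prod[of _ n])
  also have "bil (transpose_mat M) z z = r \<bullet> z" by (simp add: bil_def MTz)
  finally have fh: "bil A f h = 2 * (r \<bullet> z) - bil A z z" by simp
  have p: "post f = f - z" by (simp add: post_def z_def r_def)
  have fz: "bil A f z = r \<bullet> z" by (simp add: bil_def r_def)
  have "bil A (f - z) (f - z) = bil A f f - 2 * (r \<bullet> z) + bil A z z"
    using f z bil_sym[OF A_carrier A_sym z f] fz
    by (simp add: bil_diff_left[OF A_carrier] bil_diff_right[OF A_carrier])
  then show ?thesis using fh p by simp
qed

end

locale two_grid = smoothed_level +
  fixes m :: nat and P :: "real mat"
  assumes P_carrier: "P \<in> carrier_mat n m"
    and P_inj: "\<And>v. v \<in> carrier_vec m \<Longrightarrow> P *\<^sub>v v = 0\<^sub>v n \<Longrightarrow> v = 0\<^sub>v m"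
begin

abbreviation "Ac \<equiv> transpose_mat P * A * P"
abbreviation "K \<equiv> transpose_mat P * Mt * P"

lemma spd_Ac: "spd m Ac" by (rule spd_congruence[OF spd_A P_carrier P_inj])
lemma spd_K: "spd m K" by (rule spd_congruence[OF spd_Mt P_carrier P_inj])

lemmas Ac_carrier = spdD(1)[OF spd_Ac] and K_carrier = spdD(1)[OF spd_K]
lemmas bil_Ac = bil_congruence[OF A_carrier P_carrier]
lemmas bil_K = bil_congruence[OF Mt_carrier P_carrier]
lemmas Aci = minv_spd[OF spd_Ac spd_Ac, simplified]

lemma P_mult [simp]: "v \<in> carrier_vec m \<Longrightarrow> P *\<^sub>v v \<in> carrier_vec n"
  using P_carrier by simp

text \<open>Its kernel is the \<open>A\<close>-orthogonal complement of the range of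
  \<open>P\<close>.\<close>

definition restrict_residual :: "real vec \<Rightarrow> real vec" where
  "restrict_residual u = transpose_mat P *\<^sub>v (A *\<^sub>v u)"

definition coarse_correct :: "real mat \<Rightarrow> real vec \<Rightarrow> real vec" where
  "coarse_correct C u = u - P *\<^sub>v (C *\<^sub>v restrict_residual u)"

lemma restrict_carrier [simp]: "u \<in> carrier_vec n \<Longrightarrow> restrict_residual u \<in> carrier_vec m"
  using P_carrier A_carrier by (simp add: restrict_residual_def)

lemma correct_carrier [simp]:
  "C \<in> carrier_mat m m \<Longrightarrow> u \<in> carrier_vec n \<Longrightarrow> coarse_correct C u \<in> carrier_vec n"
  by (simp add: coarse_correct_def)

lemma bil_restrict:
  "u \<in> carrier_vec n \<Longrightarrow> c \<in> carrier_vec m \<Longrightarrow> bil A u (P *\<^sub>v c) = restrict_residual u \<bullet> c"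
  unfolding bil_def restrict_residual_def
  using scalar_prod_transpose[OF P_carrier, of c "A *\<^sub>v u"] A_carrier by simp

lemma restrict_P: "c \<in> carrier_vec m \<Longrightarrow> restrict_residual (P *\<^sub>v c) = Ac *\<^sub>v c"
  unfolding restrict_residual_def using P_carrier A_carrier
  by (simp add: assoc_mult_mat_vec[of _ m n _ m] assoc_mult_mat_vec[of _ m n _ n])

lemma restrict_diff:
  assumes "u \<in> carrier_vec n" "v \<in> carrier_vec n"
  shows "restrict_residual (u - v) = restrict_residual u - restrict_residual v"
  using assms P_carrier A_carrier unfolding restrict_residual_def
  by (simp add: mult_minus_distrib_mat_vec[of _ n n] mult_minus_distrib_mat_vec[of _ m n])

lemma cycle_error_vec:
  assumes C: "C \<in> carrier_mat m m" and v: "v \<in> carrier_vec n"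
  shows "cycle_error A P M C *\<^sub>v v = post (coarse_correct C (pre v))"
proof -
  have d: "dim_row A = n" using A_carrier by simp
  have c1: "transpose_mat (minv M) * A \<in> carrier_mat n n" "minv M * A \<in> carrier_mat n n"
      "P * C * transpose_mat P * A \<in> carrier_mat n n"
    using Mi(1) A_carrier P_carrier C by auto
  have 1: "(1\<^sub>m n - minv M * A) *\<^sub>v v = pre v" if "v \<in> carrier_vec n" for v
    using that c1 Mi(1) A_carrier
    by (simp add: pre_def minus_mult_distrib_mat_vec[of _ n n] assoc_mult_mat_vec[of _ n n _ n])
  have 2: "(1\<^sub>m n - transpose_mat (minv M) * A) *\<^sub>v v = post v" if "v \<in> carrier_vec n" for v
    using that c1 Mi(1) A_carrier
    by (simp add: post_def minus_mult_distrib_mat_vec[of _ n n] assoc_mult_mat_vec[of _ n n _ n])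
  have 3: "(1\<^sub>m n - P * C * transpose_mat P * A) *\<^sub>v v = coarse_correct C v" if "v \<in> carrier_vec n" for v
  proof -
    have "(P * C * transpose_mat P * A) *\<^sub>v v = (P * C * transpose_mat P) *\<^sub>v (A *\<^sub>v v)"
      using that A_carrier P_carrier C by (intro assoc_mult_mat_vec[of _ n n _ n]) auto
    also have "\<dots> = (P * C) *\<^sub>v restrict_residual v"
      unfolding restrict_residual_def
      using that A_carrier P_carrier C by (intro assoc_mult_mat_vec[of _ n m _ n]) auto
    also have "\<dots> = P *\<^sub>v (C *\<^sub>v restrict_residual v)"
      using that P_carrier C by (intro assoc_mult_mat_vec[of _ n m _ m]) auto
    finally have e: "(P * C * transpose_mat P * A) *\<^sub>v v = P *\<^sub>v (C *\<^sub>v restrict_residual v)" .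
    have "(1\<^sub>m n - P * C * transpose_mat P * A) *\<^sub>v v = 1\<^sub>m n *\<^sub>v v - (P * C * transpose_mat P * A) *\<^sub>v v"
      using c1(3) that by (intro minus_mult_distrib_mat_vec[of _ n n]) auto
    then show ?thesis unfolding e coarse_correct_def using that by simp
  qed
  have c2: "1\<^sub>m n - transpose_mat (minv M) * A \<in> carrier_mat n n" "1\<^sub>m n - minv M * A \<in> carrier_mat n n"
      "1\<^sub>m n - P * C * transpose_mat P * A \<in> carrier_mat n n"
    using c1 by (auto intro: minus_carrier_mat)
  have "cycle_error A P M C *\<^sub>v v = ((1\<^sub>m n - transpose_mat (minv M) * A) *
      (1\<^sub>m n - P * C * transpose_mat P * A)) *\<^sub>v ((1\<^sub>m n - minv M * A) *\<^sub>v v)"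
    unfolding cycle_error_def d
    using c2 v by (intro assoc_mult_mat_vec[of _ n n _ n]) auto
  also have "\<dots> = (1\<^sub>m n - transpose_mat (minv M) * A) *\<^sub>v
      ((1\<^sub>m n - P * C * transpose_mat P * A) *\<^sub>v ((1\<^sub>m n - minv M * A) *\<^sub>v v))"
    using c2 v by (intro assoc_mult_mat_vec[of _ n n _ n]) auto
  finally show ?thesis using 1 2 3 v C by simp
qed

lemma cycle_error_carrier: "cycle_error A P M C \<in> carrier_mat n n"
  using A_carrier Mi(1) by (intro carrier_matI) (auto simp: cycle_error_def)

lemma coarse_correct_sym:
  assumes C: "C \<in> carrier_mat m m" "transpose_mat C = C"
    and u: "u \<in> carrier_vec n" and v: "v \<in> carrier_vec n"
  shows "bil A (coarse_correct C u) v = bil A u (coarse_correct C v)"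
proof -
  define a b where "a = C *\<^sub>v restrict_residual u" and "b = C *\<^sub>v restrict_residual v"
  have ab: "a \<in> carrier_vec m" "b \<in> carrier_vec m" using C u v by (auto simp: a_def b_def)
  have "bil A (P *\<^sub>v a) v = restrict_residual v \<bullet> a"
    using bil_sym[OF A_carrier A_sym P_mult[OF ab(1)] v] bil_restrict[OF v ab(1)] by simp
  also have "\<dots> = a \<bullet> restrict_residual v" using ab v by (intro comm_scalar_prod[of _ m]) auto
  also have "\<dots> = bil C (restrict_residual u) (restrict_residual v)" by (simp add: bil_def a_def)
  also have "\<dots> = bil C (restrict_residual v) (restrict_residual u)" using C u v by (intro bil_sym) auto
  also have "\<dots> = b \<bullet> restrict_residual u" by (simp add: bil_def b_def)
  also have "\<dots> = restrict_residual u \<bullet> b" using ab u by (intro comm_scalar_prod[of _ m]) auto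
  also have "\<dots> = bil A u (P *\<^sub>v b)" using bil_restrict[OF u ab(2)] by simp
  finally show ?thesis using u v ab unfolding coarse_correct_def a_def[symmetric] b_def[symmetric]
    by (simp add: bil_diff_left[OF A_carrier] bil_diff_right[OF A_carrier])
qed

text \<open>For the exact solver, N is the \<open>A\<close>-orthogonal projection Q onto the
  complement of the range of \<open>P\<close>. Thus E = S' Q S is Q S multiplied by its adjoint, and
  its norm is the square of the norm of Q S. This is why \<sigma> rather than its square bounds the
  energy here. The argument is carried out for the single vector v = S' f with two uses of
  Cauchy--Schwarz.\<close>

lemma two_grid_smoothing:
  assumes f: "f \<in> carrier_vec n" and Pf: "restrict_residual f = 0\<^sub>v m" and \<sigma>: "0 \<le> \<sigma>"
    and E: "\<And>v. v \<in> carrier_vec n \<Longrightarrow>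
      bil A (cycle_error A P M (minv Ac) *\<^sub>v v) (cycle_error A P M (minv Ac) *\<^sub>v v) \<le> \<sigma>\<^sup>2 * bil A v v"
  shows "bil A (post f) (post f) \<le> \<sigma> * bil A f f"
proof -
  define v where "v = post f"
  define g where "g = pre v"
  define c where "c = minv Ac *\<^sub>v restrict_residual g"
  define w where "w = coarse_correct (minv Ac) g"
  have v: "v \<in> carrier_vec n" using f by (simp add: v_def)
  have g: "g \<in> carrier_vec n" using v by (simp add: g_def)
  have c: "c \<in> carrier_vec m" using Aci(1) g by (simp add: c_def)
  have w: "w \<in> carrier_vec n" using Aci(1) g by (simp add: w_def)
  have wg: "w = g - P *\<^sub>v c" by (simp add: w_def coarse_correct_def c_def)
  have gw: "g = w + P *\<^sub>v c" unfolding wg using g P_carrier by (intro eq_vecI) auto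
  have "restrict_residual w = restrict_residual g - Ac *\<^sub>v c"
    unfolding wg using restrict_diff[OF g P_mult[OF c]] restrict_P[OF c] by simp
  also have "Ac *\<^sub>v c = restrict_residual g"
    unfolding c_def using inverse_mult_vec[OF Ac_carrier Aci(1,2) restrict_carrier[OF g]] .
  finally have Pw: "restrict_residual w = 0\<^sub>v m" using restrict_carrier[OF g] by simp
  have orth: "bil A u (P *\<^sub>v c) = 0" if "u \<in> carrier_vec n" "restrict_residual u = 0\<^sub>v m" for u
    using bil_restrict[OF that(1) c] that(2) c by simp
  \<comment> \<open>In the next two identities g may be replaced by its projection w, because f and
    w are \<open>A\<close>-orthogonal to the range of \<open>P\<close>.\<close>
  have Ev: "cycle_error A P M (minv Ac) *\<^sub>v v = post w"
    unfolding w_def g_def by (rule cycle_error_vec[OF Aci(1) v])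
  have a: "bil A v v = bil A f w"
  proof -
    have "bil A v v = bil A f g" unfolding v_def g_def by (rule post_adjoint) (use f in auto)
    also have "\<dots> = bil A f w + bil A f (P *\<^sub>v c)" unfolding gw using f w P_mult[OF c] by (intro bil_add_right[OF A_carrier])
    finally show ?thesis using orth[OF f Pf] by simp
  qed
  have b: "bil A (post w) v = bil A w w"
  proof -
    have "bil A (post w) v = bil A w g" unfolding g_def by (rule post_adjoint[OF w v])
    also have "\<dots> = bil A w w + bil A w (P *\<^sub>v c)"
      by (subst gw) (use w P_mult[OF c] in \<open>intro bil_add_right[OF A_carrier]\<close>)
    finally show ?thesis using orth[OF w Pw] by simp
  qed
  have nn: "0 \<le> bil A v v" "0 \<le> bil A w w" "0 \<le> bil A f f" using A_nonneg v w f by auto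
  note cs = bil_cauchy_schwarz[OF spd_imp_spsd[OF spd_A]]
  have "(bil A w w)\<^sup>2 \<le> bil A (post w) (post w) * bil A v v" using cs[OF post_carrier[OF w] v] unfolding b .
  also have "\<dots> \<le> \<sigma>\<^sup>2 * bil A v v * bil A v v"
    using E[OF v] nn unfolding Ev by (intro mult_right_mono)
  also have "\<dots> = (\<sigma> * bil A v v)\<^sup>2" by (simp add: power2_eq_square)
  finally have wv: "bil A w w \<le> \<sigma> * bil A v v" by (rule power2_le_imp_le[OF _ mult_nonneg_nonneg[OF \<sigma> nn(1)]])
  have "bil A v v * bil A v v \<le> bil A f f * bil A w w"
    using cs[OF f w] unfolding a[symmetric] by (simp add: power2_eq_square)
  also have "\<dots> \<le> bil A f f * (\<sigma> * bil A v v)" using wv nn by (intro mult_left_mono)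
  finally have "bil A v v * bil A v v \<le> (\<sigma> * bil A f f) * bil A v v" by (simp add: mult_ac)
  then have "bil A v v \<le> \<sigma> * bil A f f"
    using nn(1) mult_nonneg_nonneg[OF \<sigma> nn(3)] by (metis mult_le_cancel_right order_le_less)
  then show ?thesis by (simp add: v_def)
qed

text \<open>Let \<phi> be the energy product of N S v and S v, which is also that of E v and v.
  Cauchy--Schwarz and \<open>bound\<close> at u = S v give \<phi>^2 \<le> x \<phi>
  \<open>bil A v v\<close>, and cancelling one \<phi> leaves the first power of x.\<close>

lemma cycle_error_bound:
  assumes C: "C \<in> carrier_mat m m" "transpose_mat C = C" and x: "0 \<le> x"
    and nonneg: "\<And>u. u \<in> carrier_vec n \<Longrightarrow> 0 \<le> bil A (coarse_correct C u) u"
    and bound: "\<And>u. u \<in> carrier_vec n \<Longrightarrow>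
      bil A (post (coarse_correct C u)) (post (coarse_correct C u)) \<le> x * bil A (coarse_correct C u) u"
    and v: "v \<in> carrier_vec n"
  shows "0 \<le> bil A (cycle_error A P M C *\<^sub>v v) v" "bil A (cycle_error A P M C *\<^sub>v v) v \<le> x * bil A v v"
    and "w \<in> carrier_vec n \<Longrightarrow>
      bil A (cycle_error A P M C *\<^sub>v v) w = bil A v (cycle_error A P M C *\<^sub>v w)"
proof -
  define N where "N = coarse_correct C"
  have N: "N u \<in> carrier_vec n" if "u \<in> carrier_vec n" for u using C that by (simp add: N_def)
  have Ev: "cycle_error A P M C *\<^sub>v u = post (N (pre u))" if "u \<in> carrier_vec n" for u
    unfolding N_def using cycle_error_vec[OF C(1) that] .
  define \<phi> where "\<phi> = bil A (N (pre v)) (pre v)"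
  have \<phi>: "bil A (post (N (pre v))) v = \<phi>"
    unfolding \<phi>_def using N v by (intro post_adjoint) auto
  have \<phi>0: "0 \<le> \<phi>" unfolding \<phi>_def N_def using nonneg v by simp
  have "\<phi>\<^sup>2 \<le> bil A (post (N (pre v))) (post (N (pre v))) * bil A v v"
    using bil_cauchy_schwarz[OF spd_imp_spsd[OF spd_A] post_carrier[OF N[OF pre_carrier[OF v]]] v] unfolding \<phi> .
  also have "\<dots> \<le> x * \<phi> * bil A v v"
    using bound[OF pre_carrier[OF v]] A_nonneg[OF v] unfolding \<phi>_def N_def by (intro mult_right_mono)
  finally have "\<phi> * \<phi> \<le> (x * bil A v v) * \<phi>" by (simp add: power2_eq_square mult_ac)
  then have "\<phi> \<le> x * bil A v v"
    using \<phi>0 mult_nonneg_nonneg[OF x A_nonneg[OF v]] by (metis mult_le_cancel_right order_le_less)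
  then show "0 \<le> bil A (cycle_error A P M C *\<^sub>v v) v" "bil A (cycle_error A P M C *\<^sub>v v) v \<le> x * bil A v v"
    using \<phi> \<phi>0 Ev[OF v] by simp_all
  assume w: "w \<in> carrier_vec n"
  have "bil A (post (N (pre v))) w = bil A (N (pre v)) (pre w)" using N v w by (intro post_adjoint) auto
  also have "\<dots> = bil A (pre v) (N (pre w))" unfolding N_def using C v w by (intro coarse_correct_sym) auto
  also have "\<dots> = bil A (N (pre w)) (pre v)" using N v w by (intro bil_sym[OF A_carrier A_sym]) auto
  also have "\<dots> = bil A (post (N (pre w))) v" using N v w by (intro post_adjoint[symmetric]) auto
  also have "\<dots> = bil A v (post (N (pre w)))" using N v w by (intro bil_sym[OF A_carrier A_sym]) auto
  finally show "bil A (cycle_error A P M C *\<^sub>v v) w = bil A v (cycle_error A P M C *\<^sub>v w)"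
    using Ev[OF v] Ev[OF w] by simp
qed


text \<open>In \<open>coarse\<close>, put y = C Ac z and D = C^{-1} - Ac. Then \<open>c\<close>
  stands for K^{-1} D y, and the right side is \<delta> times the form of D at y.\<close>

lemma inexact_coarse_bound:
  assumes C: "C \<in> carrier_mat m m" and u: "u \<in> carrier_vec n"
    and par: "0 < \<epsilon>" "0 \<le> \<sigma>" "\<sigma> < x" "x < 1 - \<epsilon>"
    and \<delta>: "\<delta> = \<epsilon> * (x - \<sigma>) / ((1 - \<sigma>) * (1 - \<epsilon> - x))"
    and \<epsilon>: "\<And>v. v \<in> carrier_vec n \<Longrightarrow> \<epsilon> * bil Mt v v \<le> bil A v v"
    and smooth: "\<And>f. f \<in> carrier_vec n \<Longrightarrow> restrict_residual f = 0\<^sub>v m \<Longrightarrow>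
      bil A (post f) (post f) \<le> \<sigma> * bil A f f"
    and coarse: "\<And>z c. z \<in> carrier_vec m \<Longrightarrow> c \<in> carrier_vec m \<Longrightarrow>
      K *\<^sub>v c = Ac *\<^sub>v (z - C *\<^sub>v (Ac *\<^sub>v z)) \<Longrightarrow>
      bil K c c \<le> \<delta> * (bil Ac (z - C *\<^sub>v (Ac *\<^sub>v z)) z
        - bil Ac (z - C *\<^sub>v (Ac *\<^sub>v z)) (z - C *\<^sub>v (Ac *\<^sub>v z)))"
  shows "0 \<le> bil A (coarse_correct C u) u"
    and "bil A (post (coarse_correct C u)) (post (coarse_correct C u)) \<le> x * bil A (coarse_correct C u) u"
proof -
  note Ai = minv_spd[OF spd_A spd_A, simplified] and Ki = minv_spd[OF spd_K spd_K, simplified]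
    and Mti = minv_spd[OF spd_Mt spd_Mt, simplified]
  \<comment> \<open>The operator X of the overview, self-adjoint in the \<open>Mt\<close>-inner
    product.\<close>
  define T where "T v = minv A *\<^sub>v (Mt *\<^sub>v v)" for v
  have Tc: "T v \<in> carrier_vec n" if "v \<in> carrier_vec n" for v
    using that Ai(1) Mt_carrier by (simp add: T_def)
  have AT: "A *\<^sub>v T v = Mt *\<^sub>v v" if "v \<in> carrier_vec n" for v
    unfolding T_def using that Mt_carrier by (intro inverse_mult_vec[OF A_carrier Ai(1,2)]) simp
  have \<delta>0: "0 < \<delta>" unfolding \<delta> using par by (intro divide_pos_pos mult_pos_pos) auto
  \<comment> \<open>\<open>P z\<close> is the \<open>A\<close>-orthogonal projection of
    \<open>u\<close> onto the range of \<open>P\<close>, with remainder \<open>f\<close>. The coarse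
    solver leaves \<open>q\<close> of \<open>z\<close>, so that g = f + P q.\<close>
  define z where "z = minv Ac *\<^sub>v restrict_residual u"
  define q where "q = z - C *\<^sub>v (Ac *\<^sub>v z)"
  define f where "f = u - P *\<^sub>v z"
  define g where "g = coarse_correct C u"
  define h where "h = minv Mt *\<^sub>v (A *\<^sub>v g)"
  \<comment> \<open>Since Ac q = P^T A g = P^T Mt h, this choice makes \<open>a\<close> the
    \<open>Mt\<close>-orthogonal projection of \<open>h\<close> onto the range of
    \<open>P\<close>.\<close>
  define c where "c = minv K *\<^sub>v (Ac *\<^sub>v q)"
  define a where "a = P *\<^sub>v c"
  define b where "b = h - a"
  have z: "z \<in> carrier_vec m" using Aci(1) u by (simp add: z_def)
  have Acz: "Ac *\<^sub>v z = restrict_residual u"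
    unfolding z_def by (rule inverse_mult_vec[OF Ac_carrier Aci(1,2) restrict_carrier[OF u]])
  have q: "q \<in> carrier_vec m" unfolding q_def Acz using z C u by simp
  have f: "f \<in> carrier_vec n" using u z by (simp add: f_def)
  have g: "g \<in> carrier_vec n" using u C by (simp add: g_def)
  have Ag: "A *\<^sub>v g \<in> carrier_vec n" using g A_carrier by simp
  have h: "h \<in> carrier_vec n" using Mti(1) Ag by (simp add: h_def)
  have Acq: "Ac *\<^sub>v q \<in> carrier_vec m" by (rule mult_mat_vec_carrier[OF Ac_carrier q])
  have c: "c \<in> carrier_vec m" using Ki(1) Acq by (simp add: c_def)
  have a: "a \<in> carrier_vec n" using c by (simp add: a_def)
  have b: "b \<in> carrier_vec n" using h a by (simp add: b_def)
  have Kc: "K *\<^sub>v c = Ac *\<^sub>v q"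
    unfolding c_def by (rule inverse_mult_vec[OF K_carrier Ki(1,2) Acq])
  have Mth: "Mt *\<^sub>v h = A *\<^sub>v g"
    unfolding h_def by (rule inverse_mult_vec[OF Mt_carrier Mti(1,2) Ag])
  have rf: "restrict_residual f = 0\<^sub>v m"
    unfolding f_def using restrict_diff[OF u P_mult[OF z]] restrict_P[OF z] Acz restrict_carrier[OF u] by simp
  have Cz: "C *\<^sub>v (Ac *\<^sub>v z) \<in> carrier_vec m" unfolding Acz using C u by simp
  have gq: "g = f + P *\<^sub>v q"
  proof -
    have "P *\<^sub>v q = P *\<^sub>v z - P *\<^sub>v (C *\<^sub>v (Ac *\<^sub>v z))"
      unfolding q_def by (rule mult_minus_distrib_mat_vec[OF P_carrier z Cz])
    then show ?thesis unfolding g_def coarse_correct_def f_def Acz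
      using u P_carrier by (intro eq_vecI) auto
  qed
  have orth: "bil A f (P *\<^sub>v d) = 0" if "d \<in> carrier_vec m" for d
    using bil_restrict[OF f that] rf that by simp
  have orth': "bil A (P *\<^sub>v d) f = 0" if "d \<in> carrier_vec m" for d
    using orth[OF that] bil_sym[OF A_carrier A_sym f P_mult[OF that]] by simp
  have ufz: "u = f + P *\<^sub>v z" unfolding f_def using u P_carrier by (intro eq_vecI) auto
  have Agu: "bil A g u = bil A f f + bil Ac q z"
  proof -
    have "bil A g u = bil A (f + P *\<^sub>v q) (f + P *\<^sub>v z)" using arg_cong[OF ufz, of "bil A g"] unfolding gq .
    also have "\<dots> = bil A f f + bil Ac q z"
      using f q z orth orth' bil_Ac
      by (simp add: bil_add_left[OF A_carrier] bil_add_right[OF A_carrier] del: assoc_mult_mat_vec)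
    finally show ?thesis .
  qed
  have Agg: "bil A g g = bil A f f + bil Ac q q"
    unfolding gq using f q z orth orth' bil_Ac
    by (simp add: bil_add_left[OF A_carrier] bil_add_right[OF A_carrier] del: assoc_mult_mat_vec)
  have \<alpha>: "bil Mt a a = bil K c c" unfolding a_def using bil_K[OF c c] by simp
  have cc: "bil K c c \<le> \<delta> * (bil Ac q z - bil Ac q q)"
    using coarse[OF z c] Kc unfolding q_def by blast
  have \<alpha>0: "0 \<le> bil Mt a a" and \<beta>0: "0 \<le> bil Mt b b"
    using spsdD(3)[OF spd_imp_spsd[OF spd_Mt]] a b by auto
  \<comment> \<open>The difference of the two energies is the right side of \<open>coarse\<close>
    without its factor \<delta>. This is the source of the term \<alpha> / \<delta> in
    \<open>contraction_bound\<close>.\<close>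
  have gu: "bil A g g + bil Mt a a / \<delta> \<le> bil A g u"
  proof -
    have "bil Mt a a / \<delta> \<le> bil Ac q z - bil Ac q q"
      using cc \<delta>0 unfolding \<alpha> by (simp add: pos_divide_le_eq mult.commute)
    then show ?thesis using Agu Agg by simp
  qed
  show "0 \<le> bil A (coarse_correct C u) u"
    using gu A_nonneg[OF g] divide_nonneg_pos[OF \<alpha>0 \<delta>0] unfolding g_def by linarith

  have hab: "h = a + b" unfolding b_def using a h by (intro eq_vecI) auto
  have PMtb: "transpose_mat P *\<^sub>v (Mt *\<^sub>v b) = 0\<^sub>v m"
  proof -
    have "transpose_mat P *\<^sub>v (Mt *\<^sub>v a) = K *\<^sub>v c"
      unfolding a_def using P_carrier Mt_carrier c
      by (simp add: assoc_mult_mat_vec[of _ m n _ m] assoc_mult_mat_vec[of _ m n _ n])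
    also have "\<dots> = restrict_residual (P *\<^sub>v q)" unfolding Kc by (rule restrict_P[OF q, symmetric])
    also have "P *\<^sub>v q = g - f" unfolding gq using f P_carrier by (intro eq_vecI) auto
    also have "restrict_residual (g - f) = restrict_residual g"
      unfolding restrict_diff[OF g f] rf using restrict_carrier[OF g] by simp
    also have "\<dots> = transpose_mat P *\<^sub>v (Mt *\<^sub>v h)" unfolding restrict_residual_def Mth ..
    finally have e: "transpose_mat P *\<^sub>v (Mt *\<^sub>v a) = transpose_mat P *\<^sub>v (Mt *\<^sub>v h)" .
    have "transpose_mat P *\<^sub>v (Mt *\<^sub>v b) = transpose_mat P *\<^sub>v (Mt *\<^sub>v h) - transpose_mat P *\<^sub>v (Mt *\<^sub>v a)"
      unfolding b_def using P_carrier Mt_carrier a h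
      by (simp add: mult_minus_distrib_mat_vec[of _ n n] mult_minus_distrib_mat_vec[of _ m n])
    then show ?thesis unfolding e using P_carrier Mt_carrier h by simp
  qed
  have Mtba: "bil Mt b a = 0"
  proof -
    have "bil Mt b a = (transpose_mat P *\<^sub>v (Mt *\<^sub>v b)) \<bullet> c"
      unfolding bil_def a_def using Mt_carrier b by (intro scalar_prod_transpose[OF P_carrier c, symmetric]) simp
    then show ?thesis unfolding PMtb using c by simp
  qed
  have Mtab: "bil Mt a b = 0" using Mtba bil_sym[OF Mt_carrier Mt_sym a b] by simp

  have gT: "g = T a + T b"
  proof -
    have "T a + T b = minv A *\<^sub>v (Mt *\<^sub>v h)"
      unfolding T_def hab using a b Ai(1) Mt_carrier by (simp add: mult_add_distrib_mat_vec[of _ n n])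
    also have "\<dots> = g" unfolding Mth by (rule inverse_mult_vec[OF Ai(1) A_carrier Ai(3) g])
    finally show ?thesis ..
  qed
  have bilT: "bil A (T v) w = bil Mt v w" if "v \<in> carrier_vec n" for v w
    unfolding bil_def using AT[OF that] by simp
  \<comment> \<open>\<open>Mt\<close>-orthogonality of \<open>b\<close> becomes
    \<open>A\<close>-orthogonality of \<open>T b\<close>, which makes \<open>smooth\<close>
    applicable to \<open>T b\<close>.\<close>
  have rTb: "restrict_residual (T b) = 0\<^sub>v m" unfolding restrict_residual_def AT[OF b] PMtb ..
  define Xa Xb \<zeta> where "Xa = bil A (T a) (T a)" and "Xb = bil A (T b) (T b)" and "\<zeta> = bil A (T a) (T b)"
  have ge: "bil A g g = Xa + 2 * \<zeta> + Xb"
    unfolding gT Xa_def Xb_def \<zeta>_def using Tc[OF a] Tc[OF b] bil_sym[OF A_carrier A_sym Tc[OF b] Tc[OF a]]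
    by (simp add: bil_add_left[OF A_carrier] bil_add_right[OF A_carrier])
  have Mthh: "bil A g h = bil Mt a a + bil Mt b b"
  proof -
    have "bil A g h = bil Mt h h" unfolding bil_def Mth ..
    then show ?thesis unfolding hab using a b Mtab Mtba
      by (simp add: bil_add_left[OF Mt_carrier] bil_add_right[OF Mt_carrier])
  qed
  have postg: "bil A (post g) (post g) = bil A g g - (bil Mt a a + bil Mt b b)"
    using post_energy[OF g h Mth] Mthh by simp

  \<comment> \<open>Duality turns \<epsilon> Mt \<le> A into X \<le> 1 / \<epsilon>.\<close>
  have upper: "bil A (T v) (T v) \<le> 1 / \<epsilon> * bil Mt v v" if v: "v \<in> carrier_vec n" for v
  proof (rule bil_dual_bound[OF spd_imp_spsd[OF spd_Mt] spd_A v Tc[OF v] _ AT[OF v]])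
    show "bil Mt (T v) (T v) \<le> 1 / \<epsilon> * bil A (T v) (T v)"
      using \<epsilon>[OF Tc[OF v]] par(1) by (simp add: pos_le_divide_eq mult.commute)
  qed
  \<comment> \<open>X \<ge> 1 expresses that the energy of a post-smoothed vector is
    nonnegative.\<close>
  have lower: "bil Mt v v \<le> bil A (T v) (T v)" if v: "v \<in> carrier_vec n" for v
    using post_energy[OF Tc[OF v] v AT[OF v, symmetric]] A_nonneg[OF post_carrier[OF Tc[OF v]]] bilT[OF v] by simp
  have Xbs: "Xb - bil Mt b b \<le> \<sigma> * Xb"
    using smooth[OF Tc[OF b] rTb] post_energy[OF Tc[OF b] b AT[OF b, symmetric]]
    unfolding Xb_def bilT[OF b, of b] by simp

  \<comment> \<open>The symmetric matrix that represents X in the \<open>Mt\<close>-inner product;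
    with it, bounds on X become semidefiniteness of matrices.\<close>
  define Y where "Y = Mt * minv A * Mt"
  have Yc: "Y \<in> carrier_mat n n" using Mt_carrier Ai(1) by (simp add: Y_def)
  have Yv: "Y *\<^sub>v v = Mt *\<^sub>v T v" if "v \<in> carrier_vec n" for v
    unfolding Y_def T_def using that Mt_carrier Ai(1) by (simp add: assoc_mult_mat_vec[of _ n n _ n])
  have bilY: "bil Y v w = bil A (T v) (T w)" if v: "v \<in> carrier_vec n" and w: "w \<in> carrier_vec n" for v w
  proof -
    have "bil Y v w = bil Mt (T v) w" unfolding bil_def Yv[OF v] ..
    also have "\<dots> = bil Mt w (T v)" using bil_sym[OF Mt_carrier Mt_sym Tc[OF v] w] .
    also have "\<dots> = bil A (T w) (T v)" using bilT[OF w] by simp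
    also have "\<dots> = bil A (T v) (T w)" using bil_sym[OF A_carrier A_sym Tc[OF w] Tc[OF v]] .
    finally show ?thesis .
  qed
  have Ysym: "transpose_mat Y = Y"
  proof -
    have Ait: "transpose_mat (minv A) = minv A" using symmetric_inverse[OF A_carrier Ai A_sym] .
    have "transpose_mat Y = Mt * (minv A * Mt)"
      unfolding Y_def using transpose_mult[of "Mt * minv A" n n Mt n] transpose_mult[OF Mt_carrier Ai(1)]
        Mt_carrier Ai(1) Mt_sym Ait by simp
    then show ?thesis unfolding Y_def using Mt_carrier Ai(1) by (simp add: assoc_mult_mat[of _ n n _ n _ n])
  qed
  have eM: "(1 / \<epsilon>) \<cdot>\<^sub>m Mt \<in> carrier_mat n n" using Mt_carrier by simp
  \<comment> \<open>\<open>U\<close> represents 1 / \<epsilon> - X, and \<open>V\<close> below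
    represents X - 1. As a and b are \<open>Mt\<close>-orthogonal, the off-diagonal entry of
    \<open>U\<close> is -\<zeta>, and Cauchy--Schwarz for \<open>U\<close> is the first bound on
    \<zeta>.\<close>
  define U where "U = (1 / \<epsilon>) \<cdot>\<^sub>m Mt - Y"
  have Uc: "U \<in> carrier_mat n n" unfolding U_def by (rule minus_carrier_mat[OF Yc])
  have bilU: "bil U v w = 1 / \<epsilon> * bil Mt v w - bil A (T v) (T w)"
    if "v \<in> carrier_vec n" "w \<in> carrier_vec n" for v w
    unfolding U_def bil_minus_mat[OF eM Yc that] bil_smult_mat[OF Mt_carrier that] bilY[OF that] ..
  have U: "spsd n U"
  proof (rule spsdI[OF Uc])
    have "transpose_mat ((1 / \<epsilon>) \<cdot>\<^sub>m Mt) = (1 / \<epsilon>) \<cdot>\<^sub>m transpose_mat Mt" by (intro eq_matI) auto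
    then show "transpose_mat U = U" unfolding U_def transpose_minus[OF eM Yc] Ysym Mt_sym by simp
    show "0 \<le> bil U v v" if "v \<in> carrier_vec n" for v
      using upper[OF that] bilU[OF that that] by simp
  qed
  have h1: "\<zeta>\<^sup>2 \<le> (1 / \<epsilon> * bil Mt a a - Xa) * (1 / \<epsilon> * bil Mt b b - Xb)"
    using bil_cauchy_schwarz[OF U a b] unfolding bilU[OF a b] bilU[OF a a] bilU[OF b b] Mtab
    by (simp add: Xa_def Xb_def \<zeta>_def)

  define V where "V = Y - Mt"
  have Vc: "V \<in> carrier_mat n n" unfolding V_def by (rule minus_carrier_mat[OF Mt_carrier])
  have bilV: "bil V v w = bil A (T v) (T w) - bil Mt v w"
    if "v \<in> carrier_vec n" "w \<in> carrier_vec n" for v w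
    unfolding V_def bil_minus_mat[OF Yc Mt_carrier that] bilY[OF that] ..
  have V: "spsd n V"
  proof (rule spsdI[OF Vc])
    show "transpose_mat V = V" unfolding V_def transpose_minus[OF Yc Mt_carrier] Ysym Mt_sym ..
    show "0 \<le> bil V v v" if "v \<in> carrier_vec n" for v
      using lower[OF that] bilV[OF that that] by simp
  qed
  have Vb: "Mt *\<^sub>v (T b - b) = V *\<^sub>v b"
    unfolding V_def using b Tc[OF b] Mt_carrier Yc Yv[OF b]
    by (simp add: minus_mult_distrib_mat_vec[of _ n n] mult_minus_distrib_mat_vec[of _ n n])
  have Tbb: "T b - b \<in> carrier_vec n" using Tc[OF b] b by simp
  have MtTbb: "bil Mt (T b) b = Xb" and MtbTb: "bil Mt b (T b) = Xb"
    using bilT[OF b, of "T b"] bil_sym[OF Mt_carrier Mt_sym b Tc[OF b]] by (auto simp: Xb_def)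
  \<comment> \<open>The inequality (1 / \<epsilon> - X)(X - 1) \<ge> 0 at b, in the equivalent form
    that the square of X - 1 is at most 1 / \<epsilon> - 1 times X - 1. It is duality applied to X -
    1 \<le> 1 / \<epsilon> - 1.\<close>
  have "bil Mt (T b - b) (T b - b) \<le> (1 / \<epsilon> - 1) * bil V b b"
  proof (rule bil_dual_bound[OF V spd_Mt b Tbb _ Vb])
    show "bil V (T b - b) (T b - b) \<le> (1 / \<epsilon> - 1) * bil Mt (T b - b) (T b - b)"
      using upper[OF Tbb] unfolding bilV[OF Tbb Tbb] by (simp add: left_diff_distrib)
  qed
  then have "bil Mt (T b) (T b) - 2 * Xb + bil Mt b b \<le> (1 / \<epsilon> - 1) * (Xb - bil Mt b b)"
    unfolding bilV[OF b b] Xb_def[symmetric] using b Tc[OF b] MtTbb MtbTb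
    by (simp add: bil_diff_left[OF Mt_carrier] bil_diff_right[OF Mt_carrier])
  then have MtTT: "bil Mt (T b) (T b) \<le> (1 / \<epsilon> + 1) * Xb - 1 / \<epsilon> * bil Mt b b"
    by (simp add: algebra_simps)
  have h2: "bil Mt b b * \<zeta>\<^sup>2 \<le> bil Mt a a * ((1 / \<epsilon> * bil Mt b b - Xb) * (Xb - bil Mt b b))"
    if \<beta>: "0 < bil Mt b b"
  proof -
    define \<beta> where "\<beta> = bil Mt b b"
    \<comment> \<open>Up to the factor \<beta>, which avoids a division, \<open>d\<close> is the
      part of \<open>T b\<close> that is \<open>Mt\<close>-orthogonal to b. As a is orthogonal to b,
      only this part contributes to \<zeta>.\<close>
    define d where "d = \<beta> \<cdot>\<^sub>v T b - Xb \<cdot>\<^sub>v b"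
    have d: "d \<in> carrier_vec n" using Tc[OF b] b by (simp add: d_def)
    have "bil Mt a (T b) = \<zeta>" using bilT[OF a] by (simp add: \<zeta>_def)
    then have ad: "bil Mt a d = \<beta> * \<zeta>"
      unfolding d_def using a b Tc[OF b] Mtab
      by (simp add: bil_diff_right[OF Mt_carrier] bil_smult_right[OF Mt_carrier])
    have dd: "bil Mt d d = \<beta> * (\<beta> * bil Mt (T b) (T b) - Xb * Xb)"
      unfolding d_def using b Tc[OF b] MtTbb MtbTb
      by (simp add: bil_diff_left[OF Mt_carrier] bil_diff_right[OF Mt_carrier] bil_smult_left[OF Mt_carrier]
          bil_smult_right[OF Mt_carrier] \<beta>_def[symmetric] algebra_simps)
    have "\<beta> * (\<beta> * \<zeta>\<^sup>2) = (\<beta> * \<zeta>)\<^sup>2" by (simp add: power2_eq_square)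
    also have "\<dots> \<le> bil Mt a a * bil Mt d d"
      using bil_cauchy_schwarz[OF spd_imp_spsd[OF spd_Mt] a d] unfolding ad .
    also have "\<dots> = \<beta> * (bil Mt a a * (\<beta> * bil Mt (T b) (T b) - Xb * Xb))" unfolding dd by simp
    finally have "\<beta> * \<zeta>\<^sup>2 \<le> bil Mt a a * (\<beta> * bil Mt (T b) (T b) - Xb * Xb)"
      using \<beta> unfolding \<beta>_def[symmetric] by simp
    also have "\<dots> \<le> bil Mt a a * ((1 / \<epsilon> * \<beta> - Xb) * (Xb - \<beta>))"
    proof (rule mult_left_mono[OF _ \<alpha>0])
      have "\<beta> * bil Mt (T b) (T b) \<le> \<beta> * ((1 / \<epsilon> + 1) * Xb - 1 / \<epsilon> * \<beta>)"
        using MtTT \<beta> unfolding \<beta>_def[symmetric] by (intro mult_left_mono) auto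
      moreover have "\<beta> * ((e + 1) * Xb - e * \<beta>) - Xb * Xb = (e * \<beta> - Xb) * (Xb - \<beta>)" for e
        by (simp add: algebra_simps)
      ultimately show "\<beta> * bil Mt (T b) (T b) - Xb * Xb \<le> (1 / \<epsilon> * \<beta> - Xb) * (Xb - \<beta>)"
        by (metis diff_right_mono)
    qed
    finally show ?thesis by (simp only: \<beta>_def)
  qed
  have "(Xa + 2 * \<zeta> + Xb) - (bil Mt a a + bil Mt b b) \<le> x * ((Xa + 2 * \<zeta> + Xb) + bil Mt a a / \<delta>)"
    by (rule contraction_bound[OF par \<delta> \<alpha>0 \<beta>0 _ _ Xbs _ h1 h2])
      (use upper[OF a] upper[OF b] lower[OF b] in \<open>simp_all add: Xa_def Xb_def\<close>)
  then have "bil A (post g) (post g) \<le> x * (bil A g g + bil Mt a a / \<delta>)" unfolding postg ge .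
  also have "\<dots> \<le> x * bil A g u" using gu par by (intro mult_left_mono) auto
  finally show "bil A (post (coarse_correct C u)) (post (coarse_correct C u)) \<le> x * bil A (coarse_correct C u) u"
    by (simp add: g_def)
qed

end

section \<open>Energy contractions and coarse solvers\<close>

lemma symmetric_of_bil:
  assumes G: "G \<in> carrier_mat n n"
    and sym: "\<And>u v. u \<in> carrier_vec n \<Longrightarrow> v \<in> carrier_vec n \<Longrightarrow> bil G u v = bil G v u"
  shows "transpose_mat G = G"
proof (rule eq_matI)
  fix i j assume "i < dim_row G" "j < dim_col G"
  then have ij: "i < n" "j < n" using G by auto
  have entry: "bil G (unit_vec n k) (unit_vec n l) = G $$ (l, k)" if "k < n" "l < n" for k l
    using that G by (simp add: bil_def)
  show "transpose_mat G $$ (i, j) = G $$ (i, j)"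
    using sym[of "unit_vec n i" "unit_vec n j"] entry[OF ij] entry[OF ij(2,1)] ij G by simp
qed (use G in auto)

text \<open>Self-adjointness and nonnegativity are carried along with the bound because the coarse
  solver built from an iterated cycle F needs F^2 \<le> \<rho> F. A norm bound does not give this
  when F has negative eigenvalues.\<close>

definition energy_contraction :: "nat \<Rightarrow> real mat \<Rightarrow> real mat \<Rightarrow> real \<Rightarrow> bool" where
  "energy_contraction n A E x \<longleftrightarrow> E \<in> carrier_mat n n \<and>
    (\<forall>u\<in>carrier_vec n. \<forall>v\<in>carrier_vec n. bil A (E *\<^sub>v u) v = bil A u (E *\<^sub>v v)) \<and>
    (\<forall>v\<in>carrier_vec n. 0 \<le> bil A (E *\<^sub>v v) v \<and> bil A (E *\<^sub>v v) v \<le> x * bil A v v)"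

lemma energy_contractionD:
  assumes "energy_contraction n A E x"
  shows "E \<in> carrier_mat n n"
    and "\<And>u v. u \<in> carrier_vec n \<Longrightarrow> v \<in> carrier_vec n \<Longrightarrow> bil A (E *\<^sub>v u) v = bil A u (E *\<^sub>v v)"
    and "\<And>v. v \<in> carrier_vec n \<Longrightarrow> 0 \<le> bil A (E *\<^sub>v v) v"
    and "\<And>v. v \<in> carrier_vec n \<Longrightarrow> bil A (E *\<^sub>v v) v \<le> x * bil A v v"
  using assms by (auto simp: energy_contraction_def)

lemma energy_contraction_spsd:
  assumes A: "spd n A" and E: "energy_contraction n A E x"
  shows "spsd n (A * E)"
proof (rule spsdI)
  note Ad = spdD[OF A] and Ed = energy_contractionD[OF E]
  have bilE: "bil (A * E) u v = bil A (E *\<^sub>v u) v" if "u \<in> carrier_vec n" for u v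
    unfolding bil_def assoc_mult_mat_vec[OF Ad(1) Ed(1) that] ..
  show c: "A * E \<in> carrier_mat n n" using Ad(1) Ed(1) by simp
  show "transpose_mat (A * E) = A * E"
  proof (rule symmetric_of_bil[OF c])
    fix u v :: "real vec" assume uv: "u \<in> carrier_vec n" "v \<in> carrier_vec n"
    have Ev: "E *\<^sub>v v \<in> carrier_vec n" using Ed(1) uv by simp
    show "bil (A * E) u v = bil (A * E) v u"
      using bilE uv Ed(2)[OF uv] bil_sym[OF Ad(1,2) uv(1) Ev] by simp
  qed
  show "0 \<le> bil (A * E) v v" if "v \<in> carrier_vec n" for v using bilE Ed(3) that by simp
qed

text \<open>E^2 \<le> x E in the energy form, by duality for the pair \<open>A * E\<close> and
  \<open>A\<close>.\<close>

lemma energy_contraction_square: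
  assumes A: "spd n A" and E: "energy_contraction n A E x" and v: "v \<in> carrier_vec n"
  shows "bil A (E *\<^sub>v v) (E *\<^sub>v v) \<le> x * bil A (E *\<^sub>v v) v"
proof -
  note Ad = spdD[OF A] and Ed = energy_contractionD[OF E]
  have bilE: "bil (A * E) u v = bil A (E *\<^sub>v u) v" if "u \<in> carrier_vec n" for u v
    unfolding bil_def assoc_mult_mat_vec[OF Ad(1) Ed(1) that] ..
  have Ev: "E *\<^sub>v v \<in> carrier_vec n" using Ed(1) v by simp
  have "bil A (E *\<^sub>v v) (E *\<^sub>v v) \<le> x * bil (A * E) v v"
  proof (rule bil_dual_bound[OF energy_contraction_spsd[OF A E] A v Ev])
    show "bil (A * E) (E *\<^sub>v v) (E *\<^sub>v v) \<le> x * bil A (E *\<^sub>v v) (E *\<^sub>v v)"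
      unfolding bilE[OF Ev] by (rule Ed(4)[OF Ev])
    show "A *\<^sub>v (E *\<^sub>v v) = A * E *\<^sub>v v" using assoc_mult_mat_vec[OF Ad(1) Ed(1) v] ..
  qed
  then show ?thesis unfolding bilE[OF v] .
qed

lemma energy_contraction_norm:
  assumes A: "spd n A" and E: "energy_contraction n A E x" and x: "0 \<le> x" and v: "v \<in> carrier_vec n"
  shows "bil A (E *\<^sub>v v) (E *\<^sub>v v) \<le> x\<^sup>2 * bil A v v"
proof -
  have "bil A (E *\<^sub>v v) (E *\<^sub>v v) \<le> x * bil A (E *\<^sub>v v) v" using energy_contraction_square[OF A E v] .
  also have "\<dots> \<le> x * (x * bil A v v)" using energy_contractionD(4)[OF E v] x by (rule mult_left_mono)
  finally show ?thesis by (simp add: power2_eq_square)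
qed

section \<open>Powers of energy contractions\<close>

lemma pow_mat_commute_vec:
  fixes E :: "real mat"
  assumes E: "E \<in> carrier_mat n n" and v: "v \<in> carrier_vec n"
  shows "E ^\<^sub>m Suc k *\<^sub>v v = E ^\<^sub>m k *\<^sub>v (E *\<^sub>v v)" "E ^\<^sub>m Suc k *\<^sub>v v = E *\<^sub>v (E ^\<^sub>m k *\<^sub>v v)"
proof -
  have Ek: "E ^\<^sub>m k \<in> carrier_mat n n" for k using E by (rule pow_carrier_mat)
  have 1: "E ^\<^sub>m Suc k *\<^sub>v v = E ^\<^sub>m k *\<^sub>v (E *\<^sub>v v)" if "v \<in> carrier_vec n" for k v
    using assoc_mult_mat_vec[OF Ek E that] by simp
  then show "E ^\<^sub>m Suc k *\<^sub>v v = E ^\<^sub>m k *\<^sub>v (E *\<^sub>v v)" using v .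
  show "E ^\<^sub>m Suc k *\<^sub>v v = E *\<^sub>v (E ^\<^sub>m k *\<^sub>v v)" using v
  proof (induction k arbitrary: v)
    case 0
    then show ?case using 1[OF 0, of 0] E by simp
  next
    case (Suc k)
    have Ev: "E *\<^sub>v v \<in> carrier_vec n" using E Suc.prems by simp
    show ?case unfolding 1[OF Suc.prems] Suc.IH[OF Ev] ..
  qed
qed

lemma energy_contraction_power:
  assumes A: "spd n A" and E: "energy_contraction n A E x" and x: "0 \<le> x"
  shows "energy_contraction n A (E ^\<^sub>m k) (x ^ k)"
proof -
  note Ad = spdD[OF A] and Ed = energy_contractionD[OF E]
  have Ek: "E ^\<^sub>m k \<in> carrier_mat n n" for k using Ed(1) by (rule pow_carrier_mat)
  note step = pow_mat_commute_vec[OF Ed(1)]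
  have Ev: "E *\<^sub>v v \<in> carrier_vec n" if "v \<in> carrier_vec n" for v using Ed(1) that by simp
  have Ekv: "E ^\<^sub>m k *\<^sub>v v \<in> carrier_vec n" if "v \<in> carrier_vec n" for k v
    using Ek that by (rule mult_mat_vec_carrier)
  have zero: "E ^\<^sub>m 0 *\<^sub>v v = v" if "v \<in> carrier_vec n" for v using Ed(1) that by simp
  have sa: "bil A (E ^\<^sub>m k *\<^sub>v u) v = bil A u (E ^\<^sub>m k *\<^sub>v v)"
    if "u \<in> carrier_vec n" "v \<in> carrier_vec n" for u v
    using that
  proof (induction k arbitrary: u v)
    case 0
    show ?case unfolding zero[OF 0(1)] zero[OF 0(2)] ..
  next
    case (Suc k)
    show ?case unfolding step(1)[OF Suc.prems(1)] step(2)[OF Suc.prems(2)]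
      using Suc.IH[OF Ev[OF Suc.prems(1)] Suc.prems(2)] Ed(2)[OF Suc.prems(1) Ekv[OF Suc.prems(2)]] by simp
  qed
  have A0: "0 \<le> bil A v v" if "v \<in> carrier_vec n" for v using spsdD(3)[OF spd_imp_spsd[OF A] that] .
  have "0 \<le> bil A (E ^\<^sub>m k *\<^sub>v v) v \<and> bil A (E ^\<^sub>m k *\<^sub>v v) v \<le> x ^ k * bil A v v"
    if "v \<in> carrier_vec n" for v
    using that
  \<comment> \<open>Self-adjointness moves one factor E to each side, so the form of E^(k+2) at v is
    the form of E^k at E v. The induction therefore advances by two and needs a base case for each
    parity.\<close>
  proof (induction k arbitrary: v rule: induct_nat_012)
    case 0
    then show ?case unfolding zero[OF 0] using A0[OF 0] by simp
  next
    case 1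
    have "E ^\<^sub>m Suc 0 *\<^sub>v v = E *\<^sub>v v" using step(1)[OF 1, of 0] zero[OF Ev[OF 1]] by simp
    then show ?case using Ed(3,4)[OF 1] by simp
  next
    case (ge2 k)
    note v = ge2.prems
    have "E ^\<^sub>m Suc (Suc k) *\<^sub>v v = E *\<^sub>v (E ^\<^sub>m k *\<^sub>v (E *\<^sub>v v))"
      unfolding step(2)[OF v, of "Suc k"] step(1)[OF v, of k] ..
    then have eq: "bil A (E ^\<^sub>m Suc (Suc k) *\<^sub>v v) v = bil A (E ^\<^sub>m k *\<^sub>v (E *\<^sub>v v)) (E *\<^sub>v v)"
      using Ed(2)[OF Ekv[OF Ev[OF v]] v] by simp
    have "bil A (E ^\<^sub>m k *\<^sub>v (E *\<^sub>v v)) (E *\<^sub>v v) \<le> x ^ k * bil A (E *\<^sub>v v) (E *\<^sub>v v)"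
      using ge2.IH(1)[OF Ev[OF v]] by blast
    also have "\<dots> \<le> x ^ k * (x\<^sup>2 * bil A v v)"
      using energy_contraction_norm[OF A E x v] x by (intro mult_left_mono) auto
    also have "\<dots> = x ^ Suc (Suc k) * bil A v v" by (simp add: power2_eq_square)
    finally show ?case unfolding eq using ge2.IH(1)[OF Ev[OF v]] by blast
  qed
  then show ?thesis unfolding energy_contraction_def using sa Ek by blast
qed

section \<open>Energy norms, and the two kinds of coarse solver\<close>

lemma energy_norm_vec_bil: "energy_norm_vec A v = sqrt (bil A v v)"
  by (simp add: energy_norm_vec_def bil_def)

lemma energy_norm_le:
  assumes n: "1 \<le> n" and A: "spd n A" and x: "0 \<le> x"
    and le: "\<And>v. v \<in> carrier_vec n \<Longrightarrow> bil A (B *\<^sub>v v) (B *\<^sub>v v) \<le> x\<^sup>2 * bil A v v"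
  shows "energy_norm A B \<le> x"
proof -
  have d: "dim_row A = n" using spdD(1)[OF A] by simp
  have "unit_vec n 0 \<in> carrier_vec n - {0\<^sub>v n :: real vec}" using unit_vec_nonzero[OF n] by simp
  then have ne: "carrier_vec n - {0\<^sub>v n :: real vec} \<noteq> {}" by blast
  show ?thesis unfolding energy_norm_def d
  proof (rule cSUP_least[OF ne])
    fix v :: "real vec" assume "v \<in> carrier_vec n - {0\<^sub>v n}"
    then have v: "v \<in> carrier_vec n" and pos: "0 < bil A v v" using spdD(3)[OF A] by auto
    have "sqrt (bil A (B *\<^sub>v v) (B *\<^sub>v v)) \<le> sqrt (x\<^sup>2 * bil A v v)" using le[OF v] by simp
    also have "\<dots> = x * sqrt (bil A v v)" using x by (simp add: real_sqrt_mult)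
    finally show "energy_norm_vec A (B *\<^sub>v v) / energy_norm_vec A v \<le> x"
      unfolding energy_norm_vec_bil using pos by (simp add: pos_divide_le_eq)
  qed
qed

text \<open>A real supremum says something only about a nonempty bounded set. A nonzero vector
  exists by 1 \<le> n, and boundedness comes from comparing B^T A B with A.\<close>

lemma energy_norm_bound:
  assumes n: "1 \<le> n" and A: "spd n A" and B: "B \<in> carrier_mat n n"
  shows "0 \<le> energy_norm A B"
    and "v \<in> carrier_vec n \<Longrightarrow> bil A (B *\<^sub>v v) (B *\<^sub>v v) \<le> (energy_norm A B)\<^sup>2 * bil A v v"
proof -
  define X where "X = carrier_vec n - {0\<^sub>v n :: real vec}"
  define \<phi> where "\<phi> v = energy_norm_vec A (B *\<^sub>v v) / energy_norm_vec A v" for v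
  note Ad = spdD[OF A]
  have Bv: "B *\<^sub>v v \<in> carrier_vec n" if "v \<in> carrier_vec n" for v using B that by simp
  have Bv0: "0 \<le> bil A (B *\<^sub>v v) (B *\<^sub>v v)" if "v \<in> carrier_vec n" for v
    using spsdD(3)[OF spd_imp_spsd[OF A] Bv[OF that]] .
  have en: "energy_norm A B = (SUP v\<in>X. \<phi> v)"
    using Ad(1) by (simp add: energy_norm_def X_def \<phi>_def)
  have u: "unit_vec n 0 \<in> X" using unit_vec_nonzero[OF n] by (simp add: X_def)
  have "transpose_mat B * A * B \<in> carrier_mat n n" using Ad(1) B by simp
  then obtain c where c: "0 < c"
    "\<And>v. v \<in> carrier_vec n \<Longrightarrow> bil (transpose_mat B * A * B) v v \<le> c * bil A v v"
    using bil_le_spd[OF A] by blast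
  have bdd: "bdd_above (\<phi> ` X)"
  proof (rule bdd_aboveI2)
    fix v assume "v \<in> X"
    then have v: "v \<in> carrier_vec n" and pos: "0 < bil A v v" using Ad(3) by (auto simp: X_def)
    have "bil A (B *\<^sub>v v) (B *\<^sub>v v) \<le> c * bil A v v"
      using c(2)[OF v] unfolding bil_congruence[OF Ad(1) B v v] .
    then have "sqrt (bil A (B *\<^sub>v v) (B *\<^sub>v v)) \<le> sqrt c * sqrt (bil A v v)"
      by (simp add: real_sqrt_mult[symmetric])
    then show "\<phi> v \<le> sqrt c" unfolding \<phi>_def energy_norm_vec_bil using pos by (simp add: pos_divide_le_eq)
  qed
  have "0 \<le> \<phi> (unit_vec n 0)"
    using Bv0[of "unit_vec n 0"] spsdD(3)[OF spd_imp_spsd[OF A], of "unit_vec n 0"]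
    unfolding \<phi>_def energy_norm_vec_bil by simp
  also have "\<dots> \<le> energy_norm A B" unfolding en by (rule cSUP_upper[OF u bdd])
  finally show nn: "0 \<le> energy_norm A B" .
  assume v: "v \<in> carrier_vec n"
  show "bil A (B *\<^sub>v v) (B *\<^sub>v v) \<le> (energy_norm A B)\<^sup>2 * bil A v v"
  proof (cases "v = 0\<^sub>v n")
    case True
    then show ?thesis using mult_mat_vec_zero[OF B] bil_zero[OF Ad(1) v] by simp
  next
    case False
    then have pos: "0 < bil A v v" using Ad(3)[OF v] by blast
    have "v \<in> X" using v False by (simp add: X_def)
    then have "\<phi> v \<le> energy_norm A B" unfolding en by (rule cSUP_upper[OF _ bdd])
    then have "sqrt (bil A (B *\<^sub>v v) (B *\<^sub>v v)) \<le> energy_norm A B * sqrt (bil A v v)"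
      unfolding \<phi>_def energy_norm_vec_bil using pos by (simp add: pos_divide_le_eq)
    then have "(sqrt (bil A (B *\<^sub>v v) (B *\<^sub>v v)))\<^sup>2 \<le> (energy_norm A B * sqrt (bil A v v))\<^sup>2"
      using Bv0[OF v] by (intro power_mono) auto
    then show ?thesis using Bv0[OF v] pos by (simp add: power_mult_distrib)
  qed
qed

text \<open>Here \<open>B\<close> is the inverse of the solver. With y = B^{-1} Ac z and q = z - y
  one has (B - Ac) y = Ac q, so the right side is \<delta> times the form of B - Ac at y. The claim
  is then duality for B - Ac \<le> \<delta> K.\<close>

lemma perturbed_coarse_solver:
  assumes Ac: "spd m Ac" and K: "spd m K" and Bc: "B \<in> carrier_mat m m" and D: "spsd m (B - Ac)"
    and le: "\<And>v. v \<in> carrier_vec m \<Longrightarrow> bil (B - Ac) v v \<le> \<delta> * bil K v v"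
  shows "minv B \<in> carrier_mat m m" "transpose_mat (minv B) = minv B"
    and "\<And>z c. z \<in> carrier_vec m \<Longrightarrow> c \<in> carrier_vec m \<Longrightarrow>
      K *\<^sub>v c = Ac *\<^sub>v (z - minv B *\<^sub>v (Ac *\<^sub>v z)) \<Longrightarrow>
      bil K c c \<le> \<delta> * (bil Ac (z - minv B *\<^sub>v (Ac *\<^sub>v z)) z
        - bil Ac (z - minv B *\<^sub>v (Ac *\<^sub>v z)) (z - minv B *\<^sub>v (Ac *\<^sub>v z)))"
proof -
  note Ad = spdD[OF Ac] and Dd = spsdD[OF D]
  have Bsplit: "bil B u v = bil Ac u v + bil (B - Ac) u v" if "u \<in> carrier_vec m" "v \<in> carrier_vec m" for u v
    using bil_minus_mat[OF Bc Ad(1) that] by simp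
  have bsym: "bil B u v = bil B v u" if "u \<in> carrier_vec m" "v \<in> carrier_vec m" for u v
    unfolding Bsplit[OF that] Bsplit[OF that(2,1)]
    using bil_sym[OF Ad(1,2) that] bil_sym[OF Dd(1,2) that] by simp
  have Bsym: "transpose_mat B = B" by (rule symmetric_of_bil[OF Bc bsym])
  have "0 < bil B v v" if "v \<in> carrier_vec m" "v \<noteq> 0\<^sub>v m" for v
    using Ad(3)[OF that] Dd(3)[OF that(1)] Bsplit[OF that(1,1)] by simp
  then have B: "spd m B" unfolding spd_def bil_def[symmetric] using Bc Bsym by blast
  note Bi = minv_spd[OF B B, simplified]
  show C: "minv B \<in> carrier_mat m m" by (rule Bi(1))
  show "transpose_mat (minv B) = minv B" by (rule symmetric_inverse[OF Bc Bi(1,2,3) Bsym])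
  fix z c :: "real vec"
  assume z: "z \<in> carrier_vec m" and c: "c \<in> carrier_vec m"
    and Kc: "K *\<^sub>v c = Ac *\<^sub>v (z - minv B *\<^sub>v (Ac *\<^sub>v z))"
  define y where "y = minv B *\<^sub>v (Ac *\<^sub>v z)"
  define q where "q = z - y"
  have Az: "Ac *\<^sub>v z \<in> carrier_vec m" using Ad(1) z by simp
  have y: "y \<in> carrier_vec m" unfolding y_def using Bi(1) Az by (rule mult_mat_vec_carrier)
  have q: "q \<in> carrier_vec m" unfolding q_def using z y by simp
  have By: "B *\<^sub>v y = Ac *\<^sub>v z" unfolding y_def by (rule inverse_mult_vec[OF Bc Bi(1,2) Az])
  have "(B - Ac) *\<^sub>v y = B *\<^sub>v y - Ac *\<^sub>v y" by (rule minus_mult_distrib_mat_vec[OF Bc Ad(1) y])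
  also have "\<dots> = Ac *\<^sub>v q" unfolding By q_def by (rule mult_minus_distrib_mat_vec[OF Ad(1) z y, symmetric])
  finally have Dy: "(B - Ac) *\<^sub>v y = Ac *\<^sub>v q" .
  have zq: "z - q = y" unfolding q_def using z y by (intro eq_vecI) auto
  have "bil Ac q z - bil Ac q q = bil Ac q (z - q)" using bil_diff_right[OF Ad(1) z q q] by simp
  also have "\<dots> = bil (B - Ac) y y" unfolding zq bil_def Dy ..
  finally have e: "bil Ac q z - bil Ac q q = bil (B - Ac) y y" .
  have Kq: "K *\<^sub>v c = Ac *\<^sub>v q" unfolding q_def y_def by (rule Kc)
  have Kc': "K *\<^sub>v c = (B - Ac) *\<^sub>v y" unfolding Dy by (rule Kq)
  have "bil K c c \<le> \<delta> * bil (B - Ac) y y" by (rule bil_dual_bound[OF D K y c le[OF c] Kc'])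
  then show "bil K c c \<le> \<delta> * (bil Ac (z - minv B *\<^sub>v (Ac *\<^sub>v z)) z
        - bil Ac (z - minv B *\<^sub>v (Ac *\<^sub>v z)) (z - minv B *\<^sub>v (Ac *\<^sub>v z)))"
    unfolding y_def[symmetric] q_def[symmetric] e .
qed

text \<open>The solver leaves q = z - C Ac z = F z. Duality for Ac \<le> \<tau> K gives \<tau>
  \<open>bil Ac q q\<close> as a bound for the left side, and F^2 \<le> \<rho> F bounds the bracket
  on the right from below by (1 / \<rho> - 1) \<open>bil Ac q q\<close>. The value of \<delta> is
  the one with \<delta> (1 / \<rho> - 1) = \<tau>.\<close>

lemma iterative_coarse_solver:
  assumes Ac: "spd m Ac" and K: "spd m K" and F: "energy_contraction m Ac F \<rho>" and \<rho>: "0 < \<rho>" "\<rho> < 1"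
    and le: "\<And>v. v \<in> carrier_vec m \<Longrightarrow> bil Ac v v \<le> \<tau> * bil K v v"
    and \<delta>: "\<delta> = \<tau> * \<rho> / (1 - \<rho>)" "0 \<le> \<delta>"
  defines "C \<equiv> (1\<^sub>m m - F) * minv Ac"
  shows "C \<in> carrier_mat m m" "transpose_mat C = C"
    and "\<And>z c. z \<in> carrier_vec m \<Longrightarrow> c \<in> carrier_vec m \<Longrightarrow>
      K *\<^sub>v c = Ac *\<^sub>v (z - C *\<^sub>v (Ac *\<^sub>v z)) \<Longrightarrow>
      bil K c c \<le> \<delta> * (bil Ac (z - C *\<^sub>v (Ac *\<^sub>v z)) z
        - bil Ac (z - C *\<^sub>v (Ac *\<^sub>v z)) (z - C *\<^sub>v (Ac *\<^sub>v z)))"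
proof -
  note Ad = spdD[OF Ac] and Ai = minv_spd[OF Ac Ac, simplified] and Fd = energy_contractionD[OF F]
  have IF: "1\<^sub>m m - F \<in> carrier_mat m m" using Fd(1) by (rule minus_carrier_mat)
  have Fv: "F *\<^sub>v v \<in> carrier_vec m" if "v \<in> carrier_vec m" for v using Fd(1) that by simp
  show C: "C \<in> carrier_mat m m" unfolding C_def using IF Ai(1) by (rule mult_carrier_mat)
  have Cv: "C *\<^sub>v u = minv Ac *\<^sub>v u - F *\<^sub>v (minv Ac *\<^sub>v u)" if u: "u \<in> carrier_vec m" for u
  proof -
    have a: "minv Ac *\<^sub>v u \<in> carrier_vec m" using Ai(1) u by simp
    have "C *\<^sub>v u = (1\<^sub>m m - F) *\<^sub>v (minv Ac *\<^sub>v u)" unfolding C_def by (rule assoc_mult_mat_vec[OF IF Ai(1) u])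
    also have "\<dots> = 1\<^sub>m m *\<^sub>v (minv Ac *\<^sub>v u) - F *\<^sub>v (minv Ac *\<^sub>v u)"
      by (rule minus_mult_distrib_mat_vec[OF one_carrier_mat Fd(1) a])
    finally show ?thesis using a by simp
  qed
  \<comment> \<open>Substituting u = Ac a and v = Ac b reduces symmetry of \<open>C\<close> to
    self-adjointness of \<open>F\<close> in the \<open>Ac\<close>-inner product.\<close>
  show "transpose_mat C = C"
  proof (rule symmetric_of_bil[OF C])
    fix u v :: "real vec" assume u: "u \<in> carrier_vec m" and v: "v \<in> carrier_vec m"
    define a b where "a = minv Ac *\<^sub>v u" and "b = minv Ac *\<^sub>v v"
    have a: "a \<in> carrier_vec m" and b: "b \<in> carrier_vec m" using Ai(1) u v by (auto simp: a_def b_def)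
    have Aa: "Ac *\<^sub>v a = u" and Ab: "Ac *\<^sub>v b = v"
      unfolding a_def b_def using inverse_mult_vec[OF Ad(1) Ai(1,2)] u v by auto
    have "bil C u v = bil Ac b (a - F *\<^sub>v a)"
      unfolding bil_def Cv[OF u] a_def[symmetric] Ab using a Fv[OF a] v by (intro comm_scalar_prod[of _ m]) auto
    also have "\<dots> = bil Ac a (b - F *\<^sub>v b)"
      unfolding bil_diff_right[OF Ad(1) a Fv[OF a] b] bil_diff_right[OF Ad(1) b Fv[OF b] a]
      using bil_sym[OF Ad(1,2) a b] Fd(2)[OF a b] bil_sym[OF Ad(1,2) b Fv[OF a]] by simp
    also have "\<dots> = bil C v u"
      unfolding bil_def Cv[OF v] b_def[symmetric] Aa using b Fv[OF b] u by (intro comm_scalar_prod[of _ m]) auto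
    finally show "bil C u v = bil C v u" .
  qed
  fix z c :: "real vec"
  assume z: "z \<in> carrier_vec m" and c: "c \<in> carrier_vec m" and Kc: "K *\<^sub>v c = Ac *\<^sub>v (z - C *\<^sub>v (Ac *\<^sub>v z))"
  define q where "q = F *\<^sub>v z"
  have q: "q \<in> carrier_vec m" unfolding q_def by (rule Fv[OF z])
  have Az: "Ac *\<^sub>v z \<in> carrier_vec m" using Ad(1) z by simp
  have "C *\<^sub>v (Ac *\<^sub>v z) = z - q"
    unfolding Cv[OF Az] inverse_mult_vec[OF Ai(1) Ad(1) Ai(3) z] q_def ..
  then have zq: "z - C *\<^sub>v (Ac *\<^sub>v z) = q" using z q by (intro eq_vecI) auto
  have 1: "bil K c c \<le> \<tau> * bil Ac q q"
    using bil_dual_bound[OF spd_imp_spsd[OF Ac] K q c le[OF c]] Kc unfolding zq by blast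
  have 2: "bil Ac q q \<le> \<rho> * bil Ac q z" unfolding q_def by (rule energy_contraction_square[OF Ac F z])
  then have "bil Ac q q / \<rho> \<le> bil Ac q z" using \<rho>(1) by (simp add: pos_divide_le_eq mult.commute)
  then have "\<delta> * (bil Ac q q / \<rho> - bil Ac q q) \<le> \<delta> * (bil Ac q z - bil Ac q q)"
    using \<delta>(2) by (intro mult_left_mono) auto
  moreover have "\<delta> * (bil Ac q q / \<rho> - bil Ac q q) = \<tau> * bil Ac q q"
  proof -
    have "bil Ac q q / \<rho> - bil Ac q q = bil Ac q q * (1 - \<rho>) / \<rho>"
      using \<rho>(1) by (simp add: right_diff_distrib diff_divide_distrib)
    then show ?thesis unfolding \<delta>(1) using \<rho> by simp
  qed
  ultimately show "bil K c c \<le> \<delta> * (bil Ac (z - C *\<^sub>v (Ac *\<^sub>v z)) z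
        - bil Ac (z - C *\<^sub>v (Ac *\<^sub>v z)) (z - C *\<^sub>v (Ac *\<^sub>v z)))"
    unfolding zq using 1 by linarith
qed

text \<open>The interface for the induction over levels: the solver enters only through its
  dimension, its symmetry and \<open>coarse\<close>, so a direct and an iterative solver can both be
  inserted.\<close>

lemma (in two_grid) cycle_energy_contraction:
  assumes par: "0 < \<epsilon>" "0 \<le> \<sigma>" "\<sigma> < x" "x < 1 - \<epsilon>"
    and \<delta>: "\<delta> = \<epsilon> * (x - \<sigma>) / ((1 - \<sigma>) * (1 - \<epsilon> - x))"
    and \<epsilon>: "\<And>v. v \<in> carrier_vec n \<Longrightarrow> \<epsilon> * bil Mt v v \<le> bil A v v"
    and TG: "\<And>v. v \<in> carrier_vec n \<Longrightarrow>
      bil A (cycle_error A P M (minv Ac) *\<^sub>v v) (cycle_error A P M (minv Ac) *\<^sub>v v) \<le> \<sigma>\<^sup>2 * bil A v v"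
    and C: "C \<in> carrier_mat m m" "transpose_mat C = C"
    and coarse: "\<And>z c. z \<in> carrier_vec m \<Longrightarrow> c \<in> carrier_vec m \<Longrightarrow>
      K *\<^sub>v c = Ac *\<^sub>v (z - C *\<^sub>v (Ac *\<^sub>v z)) \<Longrightarrow>
      bil K c c \<le> \<delta> * (bil Ac (z - C *\<^sub>v (Ac *\<^sub>v z)) z
        - bil Ac (z - C *\<^sub>v (Ac *\<^sub>v z)) (z - C *\<^sub>v (Ac *\<^sub>v z)))"
  shows "energy_contraction n A (cycle_error A P M C) x"
proof -
  have smooth: "bil A (post f) (post f) \<le> \<sigma> * bil A f f"
    if "f \<in> carrier_vec n" "restrict_residual f = 0\<^sub>v m" for f
    using two_grid_smoothing[OF that par(2) TG] .
  note ic = inexact_coarse_bound[OF C(1) _ par \<delta> \<epsilon> smooth coarse]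
  have x: "0 \<le> x" using par by simp
  show ?thesis
    unfolding energy_contraction_def
    using cycle_error_carrier cycle_error_bound[OF C x ic(1) ic(2)] by blast
qed

section \<open>Multigrid convergence\<close>

theorem theorem4p3:
  fixes L \<gamma> :: nat
    and n :: "nat \<Rightarrow> nat"
    and A P M :: "nat \<Rightarrow> real mat"
    and Ahat0 :: "real mat"
    and \<sigma> \<tau> \<epsilon> :: real
    and x :: "nat \<Rightarrow> real"
  assumes "1 \<le> L" and "1 \<le> \<gamma>"
    and "1 \<le> n 0" and "\<And>k. k \<in> {1..L} \<Longrightarrow> n (k - 1) < n k"
    and "spd (n L) (A L)"
    and "\<And>k. k \<in> {1..L} \<Longrightarrow> P k \<in> carrier_mat (n k) (n (k - 1))"
    and "\<And>k. k \<in> {1..L} \<Longrightarrow> vec_space.rank (n k) (P k) = n (k - 1)"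
    and "\<And>k. k < L \<Longrightarrow> A k = transpose_mat (P (k + 1)) * A (k + 1) * P (k + 1)"
    and "Ahat0 \<in> carrier_mat (n 0) (n 0)" and "spsd (n 0) (Ahat0 - A 0)"
    and "\<And>k. k \<in> {1..L} \<Longrightarrow> M k \<in> carrier_mat (n k) (n k)"
    and "\<And>k. k \<in> {1..L} \<Longrightarrow> invertible_mat (M k)"
    and "\<And>k. k \<in> {1..L} \<Longrightarrow> spd (n k) (M k + transpose_mat (M k) - A k)"
    and "\<sigma> = sigma_max L A P M" and "\<tau> = tau_max L A P M" and "\<epsilon> = eps_min L A M"
    and "0 < \<sigma>" and "\<sigma> < 1 - \<epsilon>"
    and "\<And>j. 1 \<le> j \<Longrightarrow> x j \<in> {\<sigma><..<1 - \<epsilon>}"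
    and "strict_antimono_on {1..} x"
    and "x \<longlonglongrightarrow> \<sigma>"
    and "\<And>j. 1 \<le> j \<Longrightarrow> 0 < x j \<and> x j < 1 \<and>
      (\<sigma> * \<epsilon> * (1 - x j ^ j) + \<tau> * (1 - \<epsilon>) * (1 - \<sigma>) * x j ^ j) /
      (\<epsilon> * (1 - x j ^ j) + \<tau> * (1 - \<sigma>) * x j ^ j) - x j = 0"
    and "spectrum (minv (transpose_mat (P 1) * symm_smoother (A 1) (M 1) * P 1) * (Ahat0 - A 0))
      \<subseteq> {0 .. \<epsilon> * (x \<gamma> - \<sigma>) / ((1 - \<sigma>) * (1 - \<epsilon> - x \<gamma>))}"
  shows "\<forall>k \<in> {1..L}. sigma_IMG \<gamma> Ahat0 A P M k \<le> x \<gamma>"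
proof -
  note L = assms(1) and \<gamma> = assms(2) and sig_eq = assms(14) and tau_eq = assms(15) and eps_eq = assms(16)
  have A_coarse: "A k = transpose_mat (P (Suc k)) * A (Suc k) * P (Suc k)" if "k < L" for k
    using assms(8)[OF that] by simp
  have P_inj: "v = 0\<^sub>v (n (k - 1))"
    if "k \<in> {1..L}" "v \<in> carrier_vec (n (k - 1))" "P k *\<^sub>v v = 0\<^sub>v (n k)" for k v
    using full_rank_injective[OF assms(6,7)[OF that(1)] that(2,3)] .
  \<comment> \<open>The induction runs downwards because every coarse matrix is built from the next
    finer one.\<close>
  have spd_A: "spd (n k) (A k)" if "k \<le> L" for k
    using that
  proof (induction rule: inc_induct)
    case base
    show ?case by (rule assms(5))
  next
    case (step k)
    have k: "Suc k \<in> {1..L}" using step.hyps by simp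
    have Pk: "P (Suc k) \<in> carrier_mat (n (Suc k)) (n k)" using assms(6)[OF k] by simp
    show ?case unfolding A_coarse[OF step.hyps(2)]
      by (rule spd_congruence[OF step.IH Pk]) (use P_inj[OF k] in simp)
  qed
  have tg: "two_grid (n k) (A k) (M k) (n (k - 1)) (P k)" if k: "k \<in> {1..L}" for k
  proof
    show "spd (n k) (A k)" using spd_A k by simp
    show "v = 0\<^sub>v (n (k - 1))" if "v \<in> carrier_vec (n (k - 1))" "P k *\<^sub>v v = 0\<^sub>v (n k)" for v
      using P_inj[OF k that] .
  qed (use assms(6,11,12,13) k in auto)
  have Ac: "transpose_mat (P k) * A k * P k = A (k - 1)" if "k \<in> {1..L}" for k
  proof -
    have "k - 1 < L" "Suc (k - 1) = k" using that by auto
    then show ?thesis using A_coarse[of "k - 1"] by simp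
  qed
  have n_pos: "1 \<le> n k" if "k \<le> L" for k
    using that
  proof (induction k)
    case 0
    show ?case by (rule assms(3))
  next
    case (Suc k)
    then show ?case using assms(4)[of "Suc k"] by simp
  qed
  have ne: "{1..L} \<noteq> {}" using L by simp

  have \<sigma>_le: "sigma_TG A P M k \<le> \<sigma>" if "k \<in> {1..L}" for k
    unfolding sig_eq sigma_max_def using that by (intro Max_ge) auto
  have \<tau>_le: "lambda_max (minv (transpose_mat (P k) * symm_smoother (A k) (M k) * P k) * A (k - 1)) \<le> \<tau>"
    if "k \<in> {1..L}" for k
    unfolding tau_eq tau_max_def using that by (intro Max_ge) auto
  have \<epsilon>_le: "\<epsilon> \<le> lambda_min (minv (symm_smoother (A k) (M k)) * A k)" if "k \<in> {1..L}" for k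
    unfolding eps_eq eps_min_def using that by (intro Min_le) auto
  have Mt: "spd (n k) (symm_smoother (A k) (M k))" if "k \<in> {1..L}" for k
    using smoothed_level.spd_Mt[OF two_grid.axioms(1)[OF tg[OF that]]] .
  have K: "spd (n (k - 1)) (transpose_mat (P k) * symm_smoother (A k) (M k) * P k)" if "k \<in> {1..L}" for k
    using two_grid.spd_K[OF tg[OF that]] .

  have \<epsilon>0: "0 < \<epsilon>"
  proof -
    have "\<epsilon> \<in> (\<lambda>k. lambda_min (minv (symm_smoother (A k) (M k)) * A k)) ` {1..L}"
      unfolding eps_eq eps_min_def using ne by (intro Min_in) auto
    then obtain k where k: "k \<in> {1..L}" and e: "\<epsilon> = lambda_min (minv (symm_smoother (A k) (M k)) * A k)"
      by blast
    show ?thesis unfolding e using lambda_min_bound(1)[OF n_pos Mt[OF k] spd_A] k by simp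
  qed
  have \<epsilon>_bound: "\<epsilon> * bil (symm_smoother (A k) (M k)) v v \<le> bil (A k) v v"
    if k: "k \<in> {1..L}" and v: "v \<in> carrier_vec (n k)" for k v
  proof -
    have "\<epsilon> * bil (symm_smoother (A k) (M k)) v v
        \<le> lambda_min (minv (symm_smoother (A k) (M k)) * A k) * bil (symm_smoother (A k) (M k)) v v"
      using \<epsilon>_le[OF k] spsdD(3)[OF spd_imp_spsd[OF Mt[OF k]] v] by (rule mult_right_mono)
    also have "\<dots> \<le> bil (A k) v v" using lambda_min_bound(2)[OF n_pos Mt[OF k] spd_A v] k by simp
    finally show ?thesis .
  qed
  have \<tau>_bound: "bil (A (k - 1)) v v \<le> \<tau> * bil (transpose_mat (P k) * symm_smoother (A k) (M k) * P k) v v"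
    if k: "k \<in> {1..L}" and v: "v \<in> carrier_vec (n (k - 1))" for k v
  proof -
    have k': "k - 1 \<le> L" using k by auto
    note Ad = spdD(1,2)[OF spd_A[OF k']]
    have "bil (A (k - 1)) v v
        \<le> lambda_max (minv (transpose_mat (P k) * symm_smoother (A k) (M k) * P k) * A (k - 1))
          * bil (transpose_mat (P k) * symm_smoother (A k) (M k) * P k) v v"
      by (rule lambda_max_bound[OF n_pos[OF k'] K[OF k] Ad v])
    also have "\<dots> \<le> \<tau> * bil (transpose_mat (P k) * symm_smoother (A k) (M k) * P k) v v"
      using \<tau>_le[OF k] spsdD(3)[OF spd_imp_spsd[OF K[OF k]] v] by (rule mult_right_mono)
    finally show ?thesis .
  qed
  have TG: "bil (A k) (cycle_error (A k) (P k) (M k) (minv (A (k - 1))) *\<^sub>v v)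
      (cycle_error (A k) (P k) (M k) (minv (A (k - 1))) *\<^sub>v v) \<le> \<sigma>\<^sup>2 * bil (A k) v v"
    if k: "k \<in> {1..L}" and v: "v \<in> carrier_vec (n k)" for k v
  proof -
    have k': "k \<le> L" using k by simp
    note nb = energy_norm_bound[OF n_pos[OF k'] spd_A[OF k'] two_grid.cycle_error_carrier[OF tg[OF k]]]
    have "(sigma_TG A P M k)\<^sup>2 \<le> \<sigma>\<^sup>2"
      using \<sigma>_le[OF k] nb(1) unfolding sigma_TG_def E_TG_def by (intro power_mono) auto
    then have "(sigma_TG A P M k)\<^sup>2 * bil (A k) v v \<le> \<sigma>\<^sup>2 * bil (A k) v v"
      using spsdD(3)[OF spd_imp_spsd[OF spd_A[OF k']] v] by (rule mult_right_mono)
    then show ?thesis using nb(2)[OF v, of "minv (A (k - 1))"] unfolding sigma_TG_def E_TG_def by linarith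
  qed

  define \<xi> where "\<xi> = x \<gamma>"
  define \<rho> where "\<rho> = \<xi> ^ \<gamma>"
  define \<delta> where "\<delta> = \<epsilon> * (\<xi> - \<sigma>) / ((1 - \<sigma>) * (1 - \<epsilon> - \<xi>))"
  have \<xi>: "\<sigma> < \<xi>" "\<xi> < 1 - \<epsilon>" "0 < \<xi>" "\<xi> < 1"
    using assms(19)[OF \<gamma>] assms(22)[OF \<gamma>] by (auto simp: \<xi>_def)
  have \<rho>: "0 < \<rho>" "\<rho> < 1" using \<xi> \<gamma> by (auto simp: \<rho>_def power_less_one_iff)
  have \<delta>0: "0 \<le> \<delta>" unfolding \<delta>_def using \<xi> \<epsilon>0 by (intro divide_nonneg_pos mult_nonneg_nonneg mult_pos_pos) auto
  have \<delta>\<tau>: "\<delta> = \<tau> * \<rho> / (1 - \<rho>)"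
  proof -
    define N where "N = \<sigma> * \<epsilon> * (1 - \<rho>) + \<tau> * (1 - \<epsilon>) * (1 - \<sigma>) * \<rho>"
    define D where "D = \<epsilon> * (1 - \<rho>) + \<tau> * (1 - \<sigma>) * \<rho>"
    have ND: "N / D = \<xi>" using assms(22)[OF \<gamma>] by (simp add: N_def D_def \<rho>_def \<xi>_def)
    \<comment> \<open>Division by zero would make the quotient 0, which \<xi> > 0 excludes.\<close>
    then have "D \<noteq> 0" using \<xi>(3) by auto
    then have "N = \<xi> * D" using ND by (simp add: field_simps)
    \<comment> \<open>N = \<xi> D, with the terms collected by the factors 1 - \<rho> and \<tau>
      \<rho>.\<close>
    then have "\<epsilon> * (\<xi> - \<sigma>) * (1 - \<rho>) = \<tau> * \<rho> * ((1 - \<sigma>) * (1 - \<epsilon> - \<xi>))"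
      unfolding N_def D_def by (simp add: algebra_simps)
    moreover have "(1 - \<sigma>) * (1 - \<epsilon> - \<xi>) \<noteq> 0" "1 - \<rho> \<noteq> 0" using \<xi> \<rho> by auto
    ultimately show ?thesis unfolding \<delta>_def by (simp add: frac_eq_eq)
  qed
  have \<sigma>0: "0 \<le> \<sigma>" using assms(17) by simp

  \<comment> \<open>The step to the next finer level for an arbitrary solver. The factor \<xi> is
    the same on every level, so the bound does not deteriorate with depth.\<close>
  have level: "energy_contraction (n (Suc k)) (A (Suc k)) (cycle_error (A (Suc k)) (P (Suc k)) (M (Suc k)) C) \<xi>"
    if k: "Suc k \<le> L" and C: "C \<in> carrier_mat (n k) (n k)" "transpose_mat C = C"
      and coarse: "\<And>z c. z \<in> carrier_vec (n k) \<Longrightarrow> c \<in> carrier_vec (n k) \<Longrightarrow>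
        transpose_mat (P (Suc k)) * symm_smoother (A (Suc k)) (M (Suc k)) * P (Suc k) *\<^sub>v c
          = A k *\<^sub>v (z - C *\<^sub>v (A k *\<^sub>v z)) \<Longrightarrow>
        bil (transpose_mat (P (Suc k)) * symm_smoother (A (Suc k)) (M (Suc k)) * P (Suc k)) c c
          \<le> \<delta> * (bil (A k) (z - C *\<^sub>v (A k *\<^sub>v z)) z
            - bil (A k) (z - C *\<^sub>v (A k *\<^sub>v z)) (z - C *\<^sub>v (A k *\<^sub>v z)))" for k C
  proof -
    have k': "Suc k \<in> {1..L}" using k by simp
    have Ac': "transpose_mat (P (Suc k)) * A (Suc k) * P (Suc k) = A k" using Ac[OF k'] by simp
    have tg': "two_grid (n (Suc k)) (A (Suc k)) (M (Suc k)) (n k) (P (Suc k))" using tg[OF k'] by simp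
    show ?thesis
    proof (rule two_grid.cycle_energy_contraction[OF tg' \<epsilon>0 \<sigma>0 \<xi>(1,2) \<delta>_def, unfolded Ac'])
      fix v :: "real vec" assume v: "v \<in> carrier_vec (n (Suc k))"
      show "\<epsilon> * bil (symm_smoother (A (Suc k)) (M (Suc k))) v v \<le> bil (A (Suc k)) v v"
        by (rule \<epsilon>_bound[OF k' v])
      show "bil (A (Suc k)) (cycle_error (A (Suc k)) (P (Suc k)) (M (Suc k)) (minv (A k)) *\<^sub>v v)
          (cycle_error (A (Suc k)) (P (Suc k)) (M (Suc k)) (minv (A k)) *\<^sub>v v) \<le> \<sigma>\<^sup>2 * bil (A (Suc k)) v v"
        using TG[OF k' v] by simp
    qed (fact C coarse)+
  qed

  \<comment> \<open>Indexed by \<open>Suc k\<close> because level 0 has no error matrix.\<close>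
  have main: "energy_contraction (n (Suc k)) (A (Suc k)) (E_IMG \<gamma> Ahat0 A P M (Suc k)) \<xi>"
    if "Suc k \<le> L" for k
    using that
  proof (induction k)
    case 0
    define K1 where "K1 = transpose_mat (P (Suc 0)) * symm_smoother (A (Suc 0)) (M (Suc 0)) * P (Suc 0)"
    have A0: "spd (n 0) (A 0)" using spd_A by simp
    have K1: "spd (n 0) K1" using K[of "Suc 0"] L by (simp add: K1_def)
    note D = spsdD[OF assms(10)]
    \<comment> \<open>The eigenvalue that dominates the Rayleigh quotient lies in the assumed
      interval, so \<delta> bounds the whole form.\<close>
    obtain \<mu> where \<mu>: "\<mu> \<in> spectrum (minv K1 * (Ahat0 - A 0))"
      "\<And>w. w \<in> carrier_vec (n 0) \<Longrightarrow> bil (Ahat0 - A 0) w w \<le> \<mu> * bil K1 w w"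
      using spectral_upper_bound[OF assms(3) K1 D(1,2)] by blast
    have "\<mu> \<le> \<delta>" using \<mu>(1) assms(23) by (auto simp: \<delta>_def \<xi>_def K1_def)
    have D_le: "bil (Ahat0 - A 0) w w \<le> \<delta> * bil K1 w w" if w: "w \<in> carrier_vec (n 0)" for w
      using \<mu>(2)[OF w] mult_right_mono[OF \<open>\<mu> \<le> \<delta>\<close> spsdD(3)[OF spd_imp_spsd[OF K1] w]] by linarith
    note solver = perturbed_coarse_solver[OF A0 K1 assms(9,10)]
    show ?case unfolding E_IMG.simps One_nat_def
      by (rule level[OF 0, folded K1_def]; rule solver; (rule D_le)?; assumption)
  next
    case (Suc k)
    define K' where "K' = transpose_mat (P (Suc (Suc k))) *
      symm_smoother (A (Suc (Suc k))) (M (Suc (Suc k))) * P (Suc (Suc k))"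
    have k: "Suc (Suc k) \<in> {1..L}" and k': "Suc k \<le> L" using Suc.prems by auto
    have K': "spd (n (Suc k)) K'" using K[OF k] by (simp add: K'_def)
    have \<tau>': "bil (A (Suc k)) v v \<le> \<tau> * bil K' v v" if "v \<in> carrier_vec (n (Suc k))" for v
      using \<tau>_bound[OF k] that by (simp add: K'_def)
    \<comment> \<open>The \<gamma> cycles on the level below contract by \<rho>. By
      \<open>\<delta>\<tau>\<close>, the resulting solver then meets the coarse condition with the
      same \<delta> as on the coarsest level.\<close>
    have IH: "energy_contraction (n (Suc k)) (A (Suc k)) (E_IMG \<gamma> Ahat0 A P M (Suc k) ^\<^sub>m \<gamma>) \<rho>"
      unfolding \<rho>_def using \<xi>(3) by (intro energy_contraction_power[OF spd_A[OF k'] Suc.IH[OF k']]) simp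
    have d: "dim_row (A (Suc k)) = n (Suc k)" using spdD(1)[OF spd_A[OF k']] by simp
    note solver = iterative_coarse_solver[OF spd_A[OF k'] K' IH \<rho> _ \<delta>\<tau> \<delta>0]
    show ?case unfolding E_IMG.simps(3) d
      by (rule level[OF Suc.prems, folded K'_def]; rule solver; (rule \<tau>')?; assumption)
  qed
  show ?thesis
  proof
    fix k assume k: "k \<in> {1..L}"
    then obtain j where j: "k = Suc j" "Suc j \<le> L" by (cases k) auto
    show "sigma_IMG \<gamma> Ahat0 A P M k \<le> x \<gamma>"
      unfolding sigma_IMG_def j(1) \<xi>_def[symmetric]
    proof (rule energy_norm_le[OF n_pos[OF j(2)] spd_A[OF j(2)]])
      show "0 \<le> \<xi>" using \<xi>(3) by simp
      then show "bil (A (Suc j)) (E_IMG \<gamma> Ahat0 A P M (Suc j) *\<^sub>v v) (E_IMG \<gamma> Ahat0 A P M (Suc j) *\<^sub>v v)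
          \<le> \<xi>\<^sup>2 * bil (A (Suc j)) v v" if "v \<in> carrier_vec (n (Suc j))" for v
        using energy_contraction_norm[OF spd_A[OF j(2)] main[OF j(2)] _ that] by blast
    qed
  qed
qed

end
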